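(* Let $n\ge 3$ and let $M$ be an $n$-dimensional generalized graph manifold. The integer $c(M,(z,f))$, i.e. the corank (number of variables minus rank) of the homogeneous linear system $LS_1(M)$ written in a Waldhausen basis $(z,f)$ of $M$, does not depend on the choice of the Waldhausen basis $(z,f)$.
   Context: Generalized graph manifolds. Let $n\ge 3$. A generalized graph manifold is a compact $n$-dimensional manifold $M=\bigcup_{v\in V}M_v$ consisting of finitely many blocks such that: (1) each block $M_v$ is homeomorphic to $T^{n-2}\times S_v$, where $T^{n-2}$ is the $(n-2)$-torus and $S_v$ is a compact connected oriented surface with boundary and with negative Euler characteristic; (2) $M$ is glued from its blocks by diffeomorphisms between their boundary $(n-1)$-tori; (3) the gluing diffeomorphisms do not identify the homotopy classes of the fiber $(n-2)$-tori. A block may be glued to itself, and some boundary tori may remain unglued (forming $\partial M$). Notation. $\partial v$ is the index set of the boundary tori of $M_v$: $\partial M_v=\bigcup_{w\in\partial v}T_w$. $W$ is the set of $w\in\bigcup_v\partial v$ with $T_w\not\subset\partial M$ (gluing tori), $W_\partial$ the set of those with $T_w\subset\partial M$. For $w\in W$, $T_w$ is glued to $T_{-w}$ by $\psi_w:T_w\to T_{-w}$, where $w\mapsto -w$ is an involution of $W$ without fixed points and $\psi_{-w}=\psi_w^{-1}$. Put $L_w=H_1(T_w,\mathbb{Z})\simeq\mathbb{Z}^{n-1}$, let $F_v\simeq\mathbb{Z}^{n-2}$ be the first homology group of the fiber torus of $M_v$, and for $w\in\partial v$ let $\iota_v^w:F_v\to L_w$ be the map induced by inclusion. Waldhausen bases.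 A set $\{z_w\in L_w\mid w\in\partial v\}$ represents a boundary if $\sum_{w\in\partial v}(\iota_w)_*z_w=0$ in $H_1(M_v,\mathbb{Z})$, where $\iota_w:T_w\to M_v$ is the inclusion. A Waldhausen basis of $M_v$ is given by a basis $(f_v^1,\dots,f_v^{n-2})$ of $F_v$ and a set $\{z_w\}_{w\in\partial v}$ representing a boundary such that for each $w\in\partial v$ the tuple $(z_w,f_w)=(z_w,\iota_v^wf_v^1,\dots,\iota_v^wf_v^{n-2})$ is a basis of $L_w$. A Waldhausen basis $(z,f)$ of $M$ is a choice of a Waldhausen basis in every block. For $w\in W$ the gluing matrix $\Psi_w\in GL_{n-1}(\mathbb{Z})$ is defined by $(z_{-w},f_{-w})=(z_w,f_w)\Psi_w$, where $L_w$ and $L_{-w}$ are identified by $(\psi_w)_*$. The system $LS_1(M)$. Its variables are real: a number $x_w$ and a row $l_w$ of length $n-2$ for each $w\in W\cup W_\partial$, and (the independent entries of) a symmetric $(n-2)\times(n-2)$ matrix $G_v$ for each $v\in V$. For $w\in\partial v$ set $$G_w=\begin{pmatrix}x_w&l_w\\ l_w^T&G_v\end{pmatrix}.$$ The system $LS_1(M)$ consists of the equations $G_{-w}=\Psi_w^TG_w\Psi_w$ for $w\in W$ and $\sum_{w\in\partial v}l_w=0$ for $v\in V$. *)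

theory Defs
  imports
    "HOL-Analysis.Analysis"
    "HOL-Homology.Homology"
    "HOL-Library.Function_Algebras"
begin

subsection \<open>Topological manifolds with boundary\<close>

definition half_space :: "nat \<Rightarrow> (nat \<Rightarrow> real) topology" where
  "half_space n = subtopology (Euclidean_space n) {x. 0 \<le> x 0}"

definition manifold_with_boundary :: "nat \<Rightarrow> 'a topology \<Rightarrow> bool" where
  "manifold_with_boundary n X \<longleftrightarrow>
     Hausdorff_space X \<and> second_countable X \<and>
     (\<forall>x\<in>topspace X. \<exists>U V. openin X U \<and> x \<in> U \<and> openin (half_space n) V \<and>
        subtopology X U homeomorphic_space subtopology (half_space n) V)"

definition manifold_interior :: "nat \<Rightarrow> 'a topology \<Rightarrow> 'a set" where
  "manifold_interior n X =
     {x \<in> topspace X. \<exists>U V. openin X U \<and> x \<in> U \<and> openin (Euclidean_space n) V \<and>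
        subtopology X U homeomorphic_space subtopology (Euclidean_space n) V}"

definition manifold_boundary :: "nat \<Rightarrow> 'a topology \<Rightarrow> 'a set" where
  "manifold_boundary n X = topspace X - manifold_interior n X"

text \<open>An orientation is a locally consistent choice of generators of the local homology groups
  at the interior points.\<close>

definition is_orientation :: "nat \<Rightarrow> 'a topology \<Rightarrow> ('a \<Rightarrow> 'a chain set) \<Rightarrow> bool" where
  "is_orientation n X \<mu> \<longleftrightarrow>
     (let I = manifold_interior n X; Y = subtopology X I;
          H = (\<lambda>U. relative_homology_group (int n) Y (I - U))
      in (\<forall>x\<in>I. \<mu> x \<in> carrier (H {x}) \<and>
                 carrier (H {x}) = range (\<lambda>k::int. \<mu> x [^]\<^bsub>H {x}\<^esub> k)) \<and>
         (\<forall>x\<in>I. \<exists>U \<alpha>. openin Y U \<and> x \<in> U \<and> \<alpha> \<in> carrier (H U) \<and>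
                 (\<forall>y\<in>U. hom_induced (int n) Y (I - U) Y (I - {y}) id \<alpha> = \<mu> y)))"

text \<open>Homology groups are written multiplicatively. The \<open>GREATEST\<close> below is meaningful for groups
  of finite rank, in particular for the homology groups of compact manifolds.\<close>

definition Z_combination :: "('g, 'm) monoid_scheme \<Rightarrow> nat \<Rightarrow> (nat \<Rightarrow> 'g) \<Rightarrow> (nat \<Rightarrow> int) \<Rightarrow> 'g" where
  "Z_combination G k b c = finprod G (\<lambda>i. b i [^]\<^bsub>G\<^esub> c i) {..<k}"

definition abelian_rank :: "('g, 'm) monoid_scheme \<Rightarrow> nat" where
  "abelian_rank G = (GREATEST k. \<exists>b\<in>{..<k} \<rightarrow> carrier G.
     \<forall>c. Z_combination G k b c = \<one>\<^bsub>G\<^esub> \<longrightarrow> (\<forall>i<k. c i = 0))"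

definition surface_Euler_characteristic :: "'a topology \<Rightarrow> int" where
  "surface_Euler_characteristic S =
     (\<Sum>p\<le>2. (- 1) ^ p * int (abelian_rank (homology_group (int p) S)))"

definition block_surface :: "'a topology \<Rightarrow> bool" where
  "block_surface S \<longleftrightarrow>
     manifold_with_boundary 2 S \<and> compact_space S \<and> connected_space S \<and>
     (\<exists>\<mu>. is_orientation 2 S \<mu>) \<and> manifold_boundary 2 S \<noteq> {} \<and>
     surface_Euler_characteristic S < 0"


subsection \<open>Standard tori and their diffeomorphisms\<close>

definition circle_topology :: "complex topology" where
  "circle_topology = top_of_set (sphere 0 1)"

definition torus :: "nat \<Rightarrow> (nat \<Rightarrow> complex) topology" where
  "torus m = product_topology (\<lambda>_. circle_topology) {..<m}"

text \<open>\<open>C\<^sup>\<infinity>\<close> functions of the first \<open>m\<close> coordinates, characterised coinductively: a function is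
  \<open>C\<^sup>\<infinity>\<close> iff it is continuous and has all first partial derivatives, and these are again \<open>C\<^sup>\<infinity>\<close>.\<close>

coinductive smooth_fun :: "nat \<Rightarrow> ((nat \<Rightarrow> real) \<Rightarrow> complex) \<Rightarrow> bool" for m where
  "\<lbrakk> continuous_on UNIV f;
     \<forall>i<m. \<exists>g. smooth_fun m g \<and>
        (\<forall>x. ((\<lambda>t. f (x(i := t))) has_vector_derivative g x) (at (x i))) \<rbrakk>
   \<Longrightarrow> smooth_fun m f"

definition torus_cover :: "nat \<Rightarrow> (nat \<Rightarrow> real) \<Rightarrow> nat \<Rightarrow> complex" where
  "torus_cover m \<theta> = (\<lambda>i\<in>{..<m}. cis (\<theta> i))"

definition smooth_torus_map :: "nat \<Rightarrow> ((nat \<Rightarrow> complex) \<Rightarrow> (nat \<Rightarrow> complex)) \<Rightarrow> bool" where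
  "smooth_torus_map m g \<longleftrightarrow> (\<forall>i<m. smooth_fun m (\<lambda>\<theta>. g (torus_cover m \<theta>) i))"

definition torus_diffeomorphism :: "nat \<Rightarrow> ((nat \<Rightarrow> complex) \<Rightarrow> (nat \<Rightarrow> complex)) \<Rightarrow> bool" where
  "torus_diffeomorphism m g \<longleftrightarrow>
     (\<exists>g'. homeomorphic_maps (torus m) (torus m) g g' \<and>
           smooth_torus_map m g \<and> smooth_torus_map m g')"


subsection \<open>Generalized graph manifolds\<close>

text \<open>
  \<open>tori\<close> is the disjoint union of the index sets of the boundary tori of the blocks, \<open>owner w\<close>
  is the block to which \<open>w\<close> belongs, and \<open>glued\<close> is the set \<open>W\<close> of gluing tori.
  \<open>circle w\<close> is the component of the boundary of the surface corresponding to \<open>w\<close>.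
  \<open>param w\<close> is a homeomorphism from the standard \<open>(n-1)\<close>-torus to \<open>T\<^sub>w\<close>; it fixes the smooth
  structure of \<open>T\<^sub>w\<close>.
  \<open>proj\<close> maps the disjoint union of the blocks onto the manifold.\<close>

record ('v, 'w, 'a, 'b, 'c) graph_manifold =
  verts :: "'v set"
  block :: "'v \<Rightarrow> 'a topology"
  surface :: "'v \<Rightarrow> 'b topology"
  triv :: "'v \<Rightarrow> 'a \<Rightarrow> (nat \<Rightarrow> complex) \<times> 'b"
  tori :: "'w set"
  owner :: "'w \<Rightarrow> 'v"
  circle :: "'w \<Rightarrow> 'b set"
  param :: "'w \<Rightarrow> (nat \<Rightarrow> complex) \<Rightarrow> 'a"
  glued :: "'w set"
  opp :: "'w \<Rightarrow> 'w"
  glue :: "'w \<Rightarrow> 'a \<Rightarrow> 'a"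
  total :: "'c topology"
  proj :: "'v \<times> 'a \<Rightarrow> 'c"

definition bdry_index :: "('v, 'w, 'a, 'b, 'c) graph_manifold \<Rightarrow> 'v \<Rightarrow> 'w set" where
  "bdry_index M v = {w \<in> tori M. owner M w = v}"

definition bdry_torus :: "('v, 'w, 'a, 'b, 'c) graph_manifold \<Rightarrow> 'w \<Rightarrow> 'a topology" where
  "bdry_torus M w = subtopology (block M (owner M w))
     {x. snd (triv M (owner M w) x) \<in> circle M w}"

text \<open>The inclusion of a fiber of \<open>T\<^sub>w\<close>. Since the circle is path connected, the homotopy class of
  this map does not depend on the chosen base point.\<close>

definition fiber_incl :: "('v, 'w, 'a, 'b, 'c) graph_manifold \<Rightarrow> 'w \<Rightarrow> (nat \<Rightarrow> complex) \<Rightarrow> 'a" where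
  "fiber_incl M w t = inv_into (topspace (block M (owner M w))) (triv M (owner M w))
     (t, SOME c. c \<in> circle M w)"

text \<open>In the second clause, that the boundary components are circles is automatic (classification of
  compact 1-manifolds), as is the finiteness of the index sets; likewise \<open>total M\<close> is automatically
  a compact manifold. In the last clause, fiber tori are taken without parametrization, so the
  comparison of homotopy classes is up to a self-homeomorphism of the fiber.\<close>

definition generalized_graph_manifold ::
    "nat \<Rightarrow> ('v, 'w, 'a, 'b, 'c) graph_manifold \<Rightarrow> bool" where
  "generalized_graph_manifold n M \<longleftrightarrow>
     finite (verts M) \<and> owner M \<in> tori M \<rightarrow> verts M \<and>
     (\<forall>v\<in>verts M.
        block_surface (surface M v) \<and>
        homeomorphic_map (block M v) (prod_topology (torus (n - 2)) (surface M v)) (triv M v) \<and>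
        finite (bdry_index M v) \<and>
        bij_betw (circle M) (bdry_index M v)
          (connected_components_of
             (subtopology (surface M v) (manifold_boundary 2 (surface M v)))) \<and>
        (\<forall>w\<in>bdry_index M v.
           subtopology (surface M v) (circle M w) homeomorphic_space circle_topology)) \<and>
     (\<forall>w\<in>tori M. homeomorphic_map (torus (n - 1)) (bdry_torus M w) (param M w)) \<and>
     glued M \<subseteq> tori M \<and>
     (\<forall>w\<in>glued M. opp M w \<in> glued M \<and> opp M w \<noteq> w \<and> opp M (opp M w) = w \<and>
        homeomorphic_maps (bdry_torus M w) (bdry_torus M (opp M w)) (glue M w) (glue M (opp M w)) \<and>
        (\<exists>g. torus_diffeomorphism (n - 1) g \<and>
           (\<forall>t\<in>topspace (torus (n - 1)). glue M w (param M w t) = param M (opp M w) (g t)))) \<and>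
     compact_space (total M) \<and> manifold_with_boundary n (total M) \<and>
     quotient_map (sum_topology (block M) (verts M)) (total M) (proj M) \<and>
     (\<forall>v\<in>verts M. \<forall>v'\<in>verts M. \<forall>x\<in>topspace (block M v). \<forall>x'\<in>topspace (block M v').
        proj M (v, x) = proj M (v', x') \<longleftrightarrow>
        (v, x) = (v', x') \<or>
        (\<exists>w\<in>glued M. owner M w = v \<and> owner M (opp M w) = v' \<and>
           x \<in> topspace (bdry_torus M w) \<and> x' = glue M w x)) \<and>
     (\<forall>w\<in>glued M. \<not> (\<exists>g. homeomorphic_map (torus (n - 2)) (torus (n - 2)) g \<and>
        homotopic_with (\<lambda>_. True) (torus (n - 2)) (bdry_torus M (opp M w))
          (glue M w \<circ> fiber_incl M w) (fiber_incl M (opp M w) \<circ> g)))"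


subsection \<open>Waldhausen bases and gluing matrices\<close>

definition is_Z_basis :: "('g, 'm) monoid_scheme \<Rightarrow> nat \<Rightarrow> (nat \<Rightarrow> 'g) \<Rightarrow> bool" where
  "is_Z_basis G k b \<longleftrightarrow> b \<in> {..<k} \<rightarrow> carrier G \<and>
     (\<forall>x\<in>carrier G. \<exists>!c. c \<in> {..<k} \<rightarrow>\<^sub>E UNIV \<and> x = Z_combination G k b c)"

definition fiber_homology :: "nat \<Rightarrow> (nat \<Rightarrow> complex) chain set monoid" where
  "fiber_homology n = homology_group 1 (torus (n - 2))"

definition torus_homology :: "('v, 'w, 'a, 'b, 'c) graph_manifold \<Rightarrow> 'w \<Rightarrow> 'a chain set monoid" where
  "torus_homology M w = homology_group 1 (bdry_torus M w)"

definition fiber_hom :: "nat \<Rightarrow> ('v, 'w, 'a, 'b, 'c) graph_manifold \<Rightarrow> 'w \<Rightarrow>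
    (nat \<Rightarrow> complex) chain set \<Rightarrow> 'a chain set" where
  "fiber_hom n M w = hom_induced 1 (torus (n - 2)) {} (bdry_torus M w) {} (fiber_incl M w)"

definition represents_boundary ::
    "('v, 'w, 'a, 'b, 'c) graph_manifold \<Rightarrow> ('w \<Rightarrow> 'a chain set) \<Rightarrow> 'v \<Rightarrow> bool" where
  "represents_boundary M z v \<longleftrightarrow>
     finprod (homology_group 1 (block M v))
       (\<lambda>w. hom_induced 1 (bdry_torus M w) {} (block M v) {} id (z w)) (bdry_index M v)
     = \<one>\<^bsub>homology_group 1 (block M v)\<^esub>"

text \<open>The tuple \<open>(z\<^sub>w, f\<^sub>w)\<close>; position \<open>0\<close> holds \<open>z\<^sub>w\<close>.\<close>

definition torus_tuple :: "nat \<Rightarrow> ('v, 'w, 'a, 'b, 'c) graph_manifold \<Rightarrow> ('w \<Rightarrow> 'a chain set) \<Rightarrow>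
    ('v \<Rightarrow> nat \<Rightarrow> (nat \<Rightarrow> complex) chain set) \<Rightarrow> 'w \<Rightarrow> nat \<Rightarrow> 'a chain set" where
  "torus_tuple n M z f w i =
     (case i of 0 \<Rightarrow> z w | Suc k \<Rightarrow> fiber_hom n M w (f (owner M w) k))"

definition Waldhausen_basis :: "nat \<Rightarrow> ('v, 'w, 'a, 'b, 'c) graph_manifold \<Rightarrow>
    ('w \<Rightarrow> 'a chain set) \<Rightarrow> ('v \<Rightarrow> nat \<Rightarrow> (nat \<Rightarrow> complex) chain set) \<Rightarrow> bool" where
  "Waldhausen_basis n M z f \<longleftrightarrow>
     (\<forall>v\<in>verts M.
        is_Z_basis (fiber_homology n) (n - 2) (f v) \<and>
        (\<forall>w\<in>bdry_index M v. z w \<in> carrier (torus_homology M w)) \<and>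
        represents_boundary M z v \<and>
        (\<forall>w\<in>bdry_index M v.
           is_Z_basis (torus_homology M w) (n - 1) (torus_tuple n M z f w)))"

text \<open>Column \<open>j\<close> of the gluing matrix consists of the coordinates of the \<open>j\<close>-th element of
  \<open>(z\<^sub>-\<^sub>w, f\<^sub>-\<^sub>w)\<close> with respect to the image of \<open>(z\<^sub>w, f\<^sub>w)\<close> under \<open>(\<psi>\<^sub>w)\<^sub>*\<close>.\<close>

definition gluing_matrix :: "nat \<Rightarrow> ('v, 'w, 'a, 'b, 'c) graph_manifold \<Rightarrow> ('w \<Rightarrow> 'a chain set) \<Rightarrow>
    ('v \<Rightarrow> nat \<Rightarrow> (nat \<Rightarrow> complex) chain set) \<Rightarrow> 'w \<Rightarrow> nat \<Rightarrow> nat \<Rightarrow> int" where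
  "gluing_matrix n M z f w i j =
     (THE c. c \<in> {..<n - 1} \<rightarrow>\<^sub>E UNIV \<and>
        torus_tuple n M z f (opp M w) j =
        Z_combination (torus_homology M (opp M w)) (n - 1)
          (\<lambda>k. hom_induced 1 (bdry_torus M w) {} (bdry_torus M (opp M w)) {} (glue M w)
                 (torus_tuple n M z f w k)) c) i"


subsection \<open>The linear system\<close>

text \<open>The independent entries of the symmetric matrix \<open>G\<^sub>v\<close> are the \<open>GVar v i j\<close> with \<open>i \<le> j\<close>.\<close>

datatype ('v, 'w) ls_var = XVar 'w | LVar 'w nat | GVar 'v nat nat

definition LS1_variables :: "nat \<Rightarrow> ('v, 'w, 'a, 'b, 'c) graph_manifold \<Rightarrow> ('v, 'w) ls_var set" where
  "LS1_variables n M =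
     {XVar w |w. w \<in> tori M} \<union>
     {LVar w k |w k. w \<in> tori M \<and> k < n - 2} \<union>
     {GVar v i j |v i j. v \<in> verts M \<and> i \<le> j \<and> j < n - 2}"

text \<open>The matrix \<open>G\<^sub>w\<close> at an assignment \<open>a\<close> of the variables, with rows and columns indexed by
  \<open>{..<n - 1}\<close>.\<close>

definition G_matrix :: "('v, 'w, 'a, 'b, 'c) graph_manifold \<Rightarrow> 'w \<Rightarrow>
    (('v, 'w) ls_var \<Rightarrow> real) \<Rightarrow> nat \<Rightarrow> nat \<Rightarrow> real" where
  "G_matrix M w a i j =
     (case (i, j) of
        (0, 0) \<Rightarrow> a (XVar w)
      | (0, Suc k) \<Rightarrow> a (LVar w k)
      | (Suc k, 0) \<Rightarrow> a (LVar w k)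
      | (Suc k, Suc l) \<Rightarrow> a (GVar (owner M w) (min k l) (max k l)))"

text \<open>An equation is given by the linear form that is required to vanish.\<close>

definition LS1_equations :: "nat \<Rightarrow> ('v, 'w, 'a, 'b, 'c) graph_manifold \<Rightarrow> ('w \<Rightarrow> 'a chain set) \<Rightarrow>
    ('v \<Rightarrow> nat \<Rightarrow> (nat \<Rightarrow> complex) chain set) \<Rightarrow> ((('v, 'w) ls_var \<Rightarrow> real) \<Rightarrow> real) set" where
  "LS1_equations n M z f =
     {(\<lambda>a. G_matrix M (opp M w) a i j -
           (\<Sum>k<n - 1. \<Sum>l<n - 1. of_int (gluing_matrix n M z f w k i) *
              G_matrix M w a k l * of_int (gluing_matrix n M z f w l j)))
        |w i j. w \<in> glued M \<and> i < n - 1 \<and> j < n - 1} \<union>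
     {(\<lambda>a. \<Sum>w\<in>bdry_index M v. a (LVar w k)) |v k. v \<in> verts M \<and> k < n - 2}"

definition rank_of_forms :: "('x \<Rightarrow> real) set \<Rightarrow> nat" where
  "rank_of_forms E = vector_space.dim (\<lambda>r e a. r * e a) E"

definition LS1_corank :: "nat \<Rightarrow> ('v, 'w, 'a, 'b, 'c) graph_manifold \<Rightarrow> ('w \<Rightarrow> 'a chain set) \<Rightarrow>
    ('v \<Rightarrow> nat \<Rightarrow> (nat \<Rightarrow> complex) chain set) \<Rightarrow> int" where
  "LS1_corank n M z f =
     int (card (LS1_variables n M)) - int (rank_of_forms (LS1_equations n M z f))"

end

(* Two Waldhausen bases differ on the torus T_w by a block triangular matrix P_w with first column
   (e_w, b_w), e_w = 1 or -1, and lower right block A_v depending only on the block v of w. Substituting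
   G'_w = P_w^T G_w P_w identifies LS_1 for the two bases, provided that on each block the signs e_w
   agree and the b_w add up to 0, so that the equations "sum of the l_w = 0" are preserved.
   The second condition follows from the first by projecting the block to its fiber torus. For the
   first, given two boundary circles C and C' of the surface S, a map from S to the circle is
   constructed that has degree 1 on C and is constant on all boundary circles other than C and C';
   its induced map on H_1 turns the two boundary relations into x + x' = 0 and e x + e' x' = 0 with x
   nonzero, hence e = e'. The map is obtained on S minus an interior point close to C, and then composed
   with a map of S into itself that misses this point and moves no boundary point outside C'. *)
theory Submission
  imports Defs
begin

subsection \<open>Half plane charts of surfaces with boundary\<close>

text \<open>With a fundamental class of the oriented surface the signs could be read off from its
  boundary. Here the surface is given by charts only, so the boundary relations are tested against
  circle-valued maps. The obstacle is that the degrees of such a map over the boundary of an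
  oriented surface add up to 0: it cannot have degree 1 on \<open>C\<close> and be constant on all
  other boundary circles. On the punctured surface the missing degree escapes through the puncture;
  pushing the surface off the puncture through \<open>C'\<close> makes it reappear on
  \<open>C'\<close>, the only circle where the values are left free. Two circles are compared at a
  time for this reason.

  The substitution of variables acts on all assignments, including values that do not belong to the
  system and on which it need not be invertible. Invertibility is therefore formulated for the
  equations and not for the assignments. Only one inequality of ranks has to be shown, since the two
  bases enter symmetrically.\<close>

definition complex_of_plane :: "(nat \<Rightarrow> real) \<Rightarrow> complex" where
  "complex_of_plane x = Complex (x 0) (x 1)"

definition plane_of_complex :: "complex \<Rightarrow> nat \<Rightarrow> real" where
  "plane_of_complex z = (\<lambda>i. if i = 0 then Re z else if i = 1 then Im z else 0)"

lemma Euclidean_space_eq: "Euclidean_space n = top_of_set {x. \<forall>i\<ge>n. x i = 0}"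
  by (simp add: Euclidean_space_def euclidean_product_topology)

text \<open>Charts are moved from sequences of reals to the type \<open>complex\<close>, where
  convexity, invariance of domain and retractions of Euclidean spaces can be applied.\<close>

lemma homeomorphic_maps_plane_complex:
  "homeomorphic_maps (Euclidean_space 2) euclidean complex_of_plane plane_of_complex"
proof -
  have 1: "continuous_on T complex_of_plane" for T
    unfolding complex_of_plane_def Complex_eq
    by (intro continuous_intros continuous_on_product_then_coordinatewise[OF continuous_on_id])
  have "continuous_on UNIV (\<lambda>z. plane_of_complex z i)" for i
    by (cases "i = 0"; cases "i = 1") (simp_all add: plane_of_complex_def continuous_intros)
  then have 2: "continuous_on UNIV plane_of_complex"
    by (rule continuous_on_coordinatewise_then_product)
  have 3: "plane_of_complex (complex_of_plane x) = x" if "\<forall>i\<ge>2. x i = 0" for x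
  proof
    fix i show "plane_of_complex (complex_of_plane x) i = x i"
      using that by (cases "i = 0"; cases "i = 1") (auto simp: plane_of_complex_def complex_of_plane_def)
  qed
  have 4: "complex_of_plane (plane_of_complex z) = z" for z
    by (simp add: plane_of_complex_def complex_of_plane_def)
  show ?thesis
    unfolding homeomorphic_maps_def Euclidean_space_eq
    using 1 2 3 4 by (auto simp: continuous_map_in_subtopology plane_of_complex_def)
qed

abbreviation right_half_plane :: "complex set" where
  "right_half_plane \<equiv> {z. 0 \<le> Re z}"

lemma interior_right_half_plane: "interior right_half_plane = {z. 0 < Re z}"
  using interior_halfspace_ge[of "1 :: complex" 0] by (simp add: inner_complex_def)

lemma homeomorphic_maps_half_space:
  "homeomorphic_maps (half_space 2) (top_of_set right_half_plane) complex_of_plane plane_of_complex"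
  unfolding half_space_def
  by (rule homeomorphic_maps_subtopologies_alt[OF homeomorphic_maps_plane_complex])
     (auto simp: complex_of_plane_def plane_of_complex_def)

lemma homeomorphic_space_open_subspace:
  assumes "X homeomorphic_space Y" "openin X V"
  obtains V' where "openin Y V'" "subtopology X V homeomorphic_space subtopology Y V'"
proof -
  obtain f where f: "homeomorphic_map X Y f"
    using assms(1) homeomorphic_space by blast
  have V: "V \<subseteq> topspace X"
    using assms(2) openin_subset by blast
  have fV: "f ` V \<subseteq> topspace Y"
    using V homeomorphic_imp_surjective_map[OF f] by blast
  show thesis
  proof
    show "openin Y (f ` V)"
      using homeomorphic_map_openness[OF f V] assms(2) by simp
    show "subtopology X V homeomorphic_space subtopology Y (f ` V)"
      using homeomorphic_map_subtopologies[OF f, of V "f ` V"] V fV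
      by (auto simp: inf.absorb2 intro: homeomorphic_map_imp_homeomorphic_space)
  qed
qed

lemma manifold_interior_2_iff:
  "x \<in> manifold_interior 2 X \<longleftrightarrow>
   (\<exists>U (V :: complex set). openin X U \<and> x \<in> U \<and> open V \<and> subtopology X U homeomorphic_space top_of_set V)"
  (is "?l \<longleftrightarrow> ?r")
proof
  have h: "Euclidean_space 2 homeomorphic_space (euclidean :: complex topology)"
    using homeomorphic_maps_plane_complex homeomorphic_space_def by blast
  {
    assume ?l
    then obtain U V where UV: "openin X U" "x \<in> U" "openin (Euclidean_space 2) V"
      "subtopology X U homeomorphic_space subtopology (Euclidean_space 2) V"
      unfolding manifold_interior_def by blast
    then show ?r
      by (metis h homeomorphic_space_open_subspace homeomorphic_space_trans open_openin)
  next
    assume ?r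
    then obtain U and V :: "complex set" where UV: "openin X U" "x \<in> U" "open V"
      "subtopology X U homeomorphic_space top_of_set V"
      by blast
    moreover have "x \<in> topspace X"
      using UV openin_subset by blast
    moreover obtain V' where "openin (Euclidean_space 2) V'"
        "top_of_set V homeomorphic_space subtopology (Euclidean_space 2) V'"
      using homeomorphic_space_open_subspace[OF homeomorphic_space_sym[THEN iffD1, OF h]] UV(3) open_openin
      by blast
    ultimately show ?l
      unfolding manifold_interior_def by (blast intro: homeomorphic_space_trans)
  }
qed

lemma openin_manifold_interior: "openin X (manifold_interior n X)"
proof (subst openin_subopen, intro ballI)
  fix x assume "x \<in> manifold_interior n X"
  then obtain U V where UV: "openin X U" "x \<in> U" "openin (Euclidean_space n) V"
    "subtopology X U homeomorphic_space subtopology (Euclidean_space n) V"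
    unfolding manifold_interior_def by blast
  then have "U \<subseteq> manifold_interior n X"
    unfolding manifold_interior_def using openin_subset[OF UV(1)] by blast
  then show "\<exists>T. openin X T \<and> x \<in> T \<and> T \<subseteq> manifold_interior n X"
    using UV by blast
qed

lemma closedin_manifold_boundary: "closedin X (manifold_boundary n X)"
  unfolding manifold_boundary_def by (simp add: openin_manifold_interior closedin_diff)

lemma half_plane_chart:
  assumes "manifold_with_boundary 2 X" "x \<in> topspace X"
  obtains U V g g' where "openin X U" "x \<in> U" "openin (top_of_set right_half_plane) V"
    "homeomorphic_maps (subtopology X U) (top_of_set V) g g'"
proof -
  obtain U V where UV: "openin X U" "x \<in> U" "openin (half_space 2) V"
    "subtopology X U homeomorphic_space subtopology (half_space 2) V"
    using assms unfolding manifold_with_boundary_def by blast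
  have "half_space 2 homeomorphic_space top_of_set right_half_plane"
    using homeomorphic_maps_half_space homeomorphic_space_def by blast
  then obtain V' where V': "openin (top_of_set right_half_plane) V'"
    "subtopology (half_space 2) V homeomorphic_space subtopology (top_of_set right_half_plane) V'"
    using homeomorphic_space_open_subspace UV(3) by blast
  moreover have "subtopology (top_of_set right_half_plane) V' = top_of_set V'"
    using openin_subset[OF V'(1)] by (simp add: subtopology_subtopology inf.absorb2)
  ultimately have "subtopology X U homeomorphic_space top_of_set V'"
    using UV(4) homeomorphic_space_trans by metis
  then show thesis
    using that UV V' unfolding homeomorphic_space_def by blast
qed

text \<open>Interior points are defined by the existence of some Euclidean chart, so a point on the
  edge of a half plane chart might have one as well. Invariance of domain excludes this: the
  transition map from the Euclidean chart is injective, so its image is open in the plane and cannot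
  touch the edge of the half plane.\<close>

lemma half_plane_chart_interior_iff:
  assumes U: "openin X U" and V: "openin (top_of_set right_half_plane) V"
    and h: "homeomorphic_maps (subtopology X U) (top_of_set V) g g'" and z: "z \<in> V"
  shows "g' z \<in> manifold_interior 2 X \<longleftrightarrow> 0 < Re z"
proof
  have U': "topspace (subtopology X U) = U"
    using openin_subset[OF U] by auto
  have g': "g' \<in> V \<rightarrow> U" and g: "g \<in> U \<rightarrow> V" and gg': "\<And>y. y \<in> V \<Longrightarrow> g (g' y) = y"
      and g'g: "\<And>y. y \<in> U \<Longrightarrow> g' (g y) = y"
    using h U' unfolding homeomorphic_maps_def continuous_map_def by auto
  obtain V0 where V0: "open V0" "V = right_half_plane \<inter> V0"
    using V by (auto simp: openin_open)
  {
    assume "0 < Re z"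
    define V1 where "V1 = V0 \<inter> {z. 0 < Re z}"
    have V1: "open V1"
      unfolding V1_def by (intro open_Int V0 open_halfspace_Re_gt)
    have V1V: "V1 \<subseteq> V"
      using V0 by (auto simp: V1_def)
    have hm: "homeomorphic_map (top_of_set V) (subtopology X U) g'"
      using h homeomorphic_maps_map homeomorphic_maps_sym by blast
    have "openin (top_of_set V) V1"
      using V1 V1V by (metis inf.absorb2 openin_open_Int)
    then have "openin (subtopology X U) (g' ` V1)"
      using homeomorphic_map_openness[OF hm] V1V by simp
    then have o: "openin X (g' ` V1)"
      using U openin_trans_full by blast
    have "homeomorphic_map (subtopology (top_of_set V) V1) (subtopology (subtopology X U) (g' ` V1)) g'"
      using homeomorphic_map_subtopologies[OF hm, of V1 "g' ` V1"] V1V g' U'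
      by (metis (no_types, lifting) homeomorphic_imp_surjective_map[OF hm] image_mono inf.absorb2 topspace_euclidean_subtopology)
    moreover have "subtopology (top_of_set V) V1 = top_of_set V1"
      using V1V by (simp add: subtopology_subtopology inf.absorb2)
    moreover have "subtopology (subtopology X U) (g' ` V1) = subtopology X (g' ` V1)"
    proof -
      have "g' ` V1 \<subseteq> U"
        using V1V g' by blast
      then show ?thesis
        by (simp add: subtopology_subtopology inf.absorb2)
    qed
    ultimately have "subtopology X (g' ` V1) homeomorphic_space top_of_set V1"
      by (metis homeomorphic_map_imp_homeomorphic_space homeomorphic_space_sym)
    moreover have "g' z \<in> g' ` V1"
      using z \<open>0 < Re z\<close> V0 by (auto simp: V1_def)
    ultimately show "g' z \<in> manifold_interior 2 X"
      unfolding manifold_interior_2_iff using V1 o by blast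
  next
    assume "g' z \<in> manifold_interior 2 X"
    then obtain U1 and V1 :: "complex set" where U1: "openin X U1" "g' z \<in> U1" "open V1"
      "subtopology X U1 homeomorphic_space top_of_set V1"
      unfolding manifold_interior_2_iff by blast
    then obtain j j' where j: "homeomorphic_maps (subtopology X U1) (top_of_set V1) j j'"
      unfolding homeomorphic_space_def by blast
    have U1': "topspace (subtopology X U1) = U1"
      using openin_subset[OF U1(1)] by auto
    have j'V: "j' \<in> V1 \<rightarrow> U1" and jU: "j \<in> U1 \<rightarrow> V1" and jj': "\<And>y. y \<in> V1 \<Longrightarrow> j (j' y) = y"
      and j'j: "\<And>y. y \<in> U1 \<Longrightarrow> j' (j y) = y" and cj': "continuous_map (top_of_set V1) (subtopology X U1) j'"
      using j U1' unfolding homeomorphic_maps_def continuous_map_def by auto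
    \<comment> \<open>The part of the Euclidean chart that lies over \<open>U\<close>; on it
      \<open>g \<circ> j'\<close> is the transition map into the half plane.\<close>
    define O1 where "O1 = {y \<in> V1. j' y \<in> U}"
    have "openin (top_of_set V1) {y \<in> topspace (top_of_set V1). j' y \<in> U1 \<inter> U}"
      by (rule openin_continuous_map_preimage[OF cj'])
         (use U U1 in \<open>auto simp: openin_subtopology Int_commute\<close>)
    moreover have "{y \<in> topspace (top_of_set V1). j' y \<in> U1 \<inter> U} = O1"
      using j'V by (auto simp: O1_def)
    ultimately have O1: "open O1"
      using U1(3) openin_open_trans by auto
    have "continuous_map (top_of_set O1) (subtopology X U) j'"
      unfolding continuous_map_in_subtopology
    proof
      have "continuous_map (top_of_set V1) X j'"
        using cj' by (simp add: continuous_map_in_subtopology)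
      then show "continuous_map (top_of_set O1) X j'"
        by (rule continuous_map_from_subtopology_mono) (auto simp: O1_def)
    qed (auto simp: O1_def)
    then have "continuous_map (top_of_set O1) (top_of_set V) (g \<circ> j')"
      using h continuous_map_compose unfolding homeomorphic_maps_def by blast
    then have c: "continuous_on O1 (g \<circ> j')" and im: "(g \<circ> j') ` O1 \<subseteq> V"
      by (auto simp: continuous_map_in_subtopology)
    have inj: "inj_on (g \<circ> j') O1"
      by (rule inj_on_inverseI[where g = "j \<circ> g'"]) (auto simp: O1_def g'g jj')
    have "open ((g \<circ> j') ` O1)"
      by (rule invariance_of_domain[OF c O1 inj])
    then have "(g \<circ> j') ` O1 \<subseteq> interior right_half_plane"
      using im V0 by (intro interior_maximal) auto
    moreover have "z \<in> (g \<circ> j') ` O1"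
    proof (rule image_eqI)
      show "z = (g \<circ> j') (j (g' z))"
        using U1(2) by (simp add: j'j gg' z)
      show "j (g' z) \<in> O1"
        using U1(2) jU g' z by (auto simp: O1_def j'j)
    qed
    ultimately show "0 < Re z"
      using interior_right_half_plane by blast
  }
qed

section \<open>Half disc charts and maps modified inside them\<close>

definition half_disc :: "complex \<Rightarrow> real \<Rightarrow> complex set" where
  "half_disc c r = cball c r \<inter> right_half_plane"

definition rel_half_disc :: "complex \<Rightarrow> real \<Rightarrow> complex set" where
  "rel_half_disc c r = ball c r \<inter> right_half_plane"

text \<open>The three discs have different roles: the compact \<open>half_disc\<close> makes a chart
  an embedding, \<open>rel_half_disc\<close> is open in the half plane and parametrizes an open set
  of the surface, and \<open>open_half_disc\<close> is open in the plane and holds the interior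
  points of that set.\<close>

definition open_half_disc :: "complex \<Rightarrow> real \<Rightarrow> complex set" where
  "open_half_disc c r = ball c r \<inter> {z. 0 < Re z}"

lemma half_disc_subsets:
  "rel_half_disc c r \<subseteq> half_disc c r" "open_half_disc c r \<subseteq> rel_half_disc c r"
  "open_half_disc c r \<subseteq> half_disc c r"
  by (auto simp: half_disc_def rel_half_disc_def open_half_disc_def)

lemma compact_half_disc: "compact (half_disc c r)"
  unfolding half_disc_def by (intro compact_Int_closed compact_cball closed_halfspace_Re_ge)

lemma convex_half_disc: "convex (half_disc c r)"
  unfolding half_disc_def by (intro convex_Int convex_cball convex_halfspace_Re_ge)

lemma open_open_half_disc: "open (open_half_disc c r)"
  unfolding open_half_disc_def by (intro open_Int open_ball open_halfspace_Re_gt)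

lemma convex_open_half_disc: "convex (open_half_disc c r)"
  unfolding open_half_disc_def by (intro convex_Int convex_ball convex_halfspace_Re_gt)

text \<open>The centre of the half disc may have positive real part, so that the interior points of the
  manifold have charts of this kind, too.\<close>

definition half_disc_chart :: "'a topology \<Rightarrow> complex \<Rightarrow> real \<Rightarrow> (complex \<Rightarrow> 'a) \<Rightarrow> bool" where
  "half_disc_chart X c r k \<longleftrightarrow> 0 < r \<and> 0 \<le> Re c \<and>
     continuous_map (top_of_set (half_disc c r)) X k \<and> inj_on k (half_disc c r) \<and>
     openin X (k ` rel_half_disc c r) \<and>
     (\<forall>z\<in>half_disc c r. k z \<in> manifold_boundary 2 X \<longleftrightarrow> Re z = 0)"

lemma half_disc_chart_exists:
  assumes "manifold_with_boundary 2 X" "x \<in> topspace X"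
  obtains c r k where "half_disc_chart X c r k" "k c = x"
proof -
  obtain U V g k where U: "openin X U" "x \<in> U" and V: "openin (top_of_set right_half_plane) V"
    and h: "homeomorphic_maps (subtopology X U) (top_of_set V) g k"
    using half_plane_chart[OF assms] by blast
  have U': "topspace (subtopology X U) = U"
    using openin_subset[OF U(1)] by auto
  have k: "k \<in> V \<rightarrow> U" and g: "g \<in> U \<rightarrow> V" and gk: "\<And>y. y \<in> V \<Longrightarrow> g (k y) = y"
      and kg: "\<And>y. y \<in> U \<Longrightarrow> k (g y) = y" 
    using h U' unfolding homeomorphic_maps_def continuous_map_def by auto
  have ck: "continuous_map (top_of_set V) X k"
    using h by (simp add: homeomorphic_maps_def continuous_map_in_subtopology)
  obtain V0 where V0: "open V0" "V = right_half_plane \<inter> V0"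
    using V by (auto simp: openin_open)
  have "g x \<in> V"
    using g U(2) by blast
  then obtain r where r: "0 < r" "cball (g x) r \<subseteq> V0"
    using V0 open_contains_cball by blast
  have D: "half_disc (g x) r \<subseteq> V"
    using r V0 by (auto simp: half_disc_def)
  have "half_disc_chart X (g x) r k"
    unfolding half_disc_chart_def
  proof (intro conjI ballI)
    show "0 \<le> Re (g x)"
      using \<open>g x \<in> V\<close> V0 by auto
    show "continuous_map (top_of_set (half_disc (g x) r)) X k"
      by (rule continuous_map_from_subtopology_mono[OF ck D])
    show "inj_on k (half_disc (g x) r)"
      by (rule inj_on_inverseI[where g = g]) (use gk D in auto)
    have hm: "homeomorphic_map (top_of_set V) (subtopology X U) k"
      using h homeomorphic_maps_map homeomorphic_maps_sym by blast
    have DV: "rel_half_disc (g x) r \<subseteq> V"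
      using D half_disc_subsets by blast
    have "rel_half_disc (g x) r = V \<inter> ball (g x) r"
      using DV V0 by (auto simp: rel_half_disc_def)
    then have "openin (top_of_set V) (rel_half_disc (g x) r)"
      by (metis open_ball openin_open_Int)
    then have "openin (subtopology X U) (k ` rel_half_disc (g x) r)"
      using homeomorphic_map_openness[OF hm] DV by simp
    then show "openin X (k ` rel_half_disc (g x) r)"
      using U openin_trans_full by blast
  next
    fix z assume z: "z \<in> half_disc (g x) r"
    then have zV: "z \<in> V"
      using D by blast
    have "k z \<in> topspace X"
      using zV k openin_subset[OF U(1)] by blast
    moreover have "0 \<le> Re z"
      using z by (simp add: half_disc_def)
    ultimately show "k z \<in> manifold_boundary 2 X \<longleftrightarrow> Re z = 0"
      using half_plane_chart_interior_iff[OF U(1) V h zV] by (auto simp: manifold_boundary_def)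
  qed (use r in auto)
  then show thesis
    using that kg U(2) by blast
qed

text \<open>A continuous map from a compact space to a Hausdorff space is closed; this is why charts
  are taken on closed half discs.\<close>

lemma half_disc_chart_homeomorphic:
  assumes "half_disc_chart X c r k" "Hausdorff_space X"
  shows "homeomorphic_map (top_of_set (half_disc c r)) (subtopology X (k ` half_disc c r)) k"
    and "closedin X (k ` half_disc c r)"
proof -
  have c: "continuous_map (top_of_set (half_disc c r)) X k" and i: "inj_on k (half_disc c r)"
    using assms by (auto simp: half_disc_chart_def)
  have cm: "compact_space (top_of_set (half_disc c r))"
    using compact_half_disc by (intro compact_space_subtopology) simp
  have cl: "closed_map (top_of_set (half_disc c r)) X k"
    by (rule continuous_imp_closed_map[OF c cm assms(2)])
  then show "closedin X (k ` half_disc c r)"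
    unfolding closed_map_def by (metis closedin_topspace topspace_euclidean_subtopology)
  have "embedding_map (top_of_set (half_disc c r)) X k"
    by (rule injective_closed_imp_embedding_map) (use c cl i in auto)
  then show "homeomorphic_map (top_of_set (half_disc c r)) (subtopology X (k ` half_disc c r)) k"
    by (simp add: embedding_map_def)
qed

text \<open>Common tool for redefining a map inside a chart; \<open>Q\<close> is empty for self-maps
  of \<open>X\<close> and a single point for the punctured map. The image of the half disc without
  \<open>Q\<close> and the complement of the image of \<open>rel_half_disc\<close> are both closed
  in \<open>X\<close> minus the image of \<open>Q\<close>, and they meet only along the round arc,
  where the two maps are required to agree.\<close>

lemma half_disc_chart_gluing:
  assumes k: "half_disc_chart X c r k" and H: "Hausdorff_space X"
    and Q: "Q \<subseteq> rel_half_disc c r"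
    and q: "continuous_map (top_of_set (half_disc c r - Q)) Y q"
    and g: "continuous_map (subtopology X (topspace X - k ` rel_half_disc c r)) Y g"
    and qg: "\<And>z. z \<in> half_disc c r \<Longrightarrow> z \<notin> rel_half_disc c r \<Longrightarrow> q z = g (k z)"
  obtains f where "continuous_map (subtopology X (topspace X - k ` Q)) Y f"
    "\<And>z. z \<in> half_disc c r \<Longrightarrow> f (k z) = q z"
    "\<And>x. x \<notin> k ` half_disc c r \<Longrightarrow> f x = g x"
proof -
  let ?D = "half_disc c r" and ?R = "rel_half_disc c r"
  let ?X' = "subtopology X (topspace X - k ` Q)"
  obtain k' where k': "homeomorphic_maps (top_of_set ?D) (subtopology X (k ` ?D)) k k'"
    using half_disc_chart_homeomorphic(1)[OF k H] unfolding homeomorphic_map_maps by blast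
  have kk: "k' (k z) = z" if "z \<in> ?D" for z
    using k' that by (auto simp: homeomorphic_maps_def)
  have top: "k ` ?D \<subseteq> topspace X"
    using half_disc_chart_homeomorphic(2)[OF k H] closedin_subset by blast
  have inj: "inj_on k ?D"
    using k by (simp add: half_disc_chart_def)
  have QD: "Q \<subseteq> ?D"
    using Q half_disc_subsets by blast
  have kQ: "k ` (?D - Q) = k ` ?D - k ` Q"
    using inj QD by (simp add: inj_on_image_set_diff)
  define f where "f x = (if x \<in> k ` ?D then q (k' x) else g x)" for x
  have fk: "f (k z) = q z" if "z \<in> ?D" for z
    using that by (auto simp: f_def kk)
  have fg: "f x = g x" if "x \<in> topspace X - k ` ?R" for x
  proof (cases "x \<in> k ` ?D")
    case True
    then obtain z where "x = k z" "z \<in> ?D"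
      by blast
    then show ?thesis
      using that fk qg by auto
  qed (simp add: f_def)
  have "continuous_map ?X' Y f"
  proof (rule pasting_lemma_closed)
    let ?T = "\<lambda>b. if b then k ` (?D - Q) else topspace X - k ` ?R"
    show "finite (UNIV :: bool set)"
      by simp
    show "closedin ?X' (?T b)" for b
    proof (cases b)
      case True
      have "k ` (?D - Q) = k ` ?D \<inter> (topspace X - k ` Q)"
        using kQ top by blast
      then show ?thesis
        using True half_disc_chart_homeomorphic(2)[OF k H] by (auto simp: closedin_subtopology)
    next
      case False
      have "openin X (k ` ?R)"
        using k by (simp add: half_disc_chart_def)
      then have "closedin X (topspace X - k ` ?R)"
        by blast
      moreover have "topspace X - k ` ?R = (topspace X - k ` ?R) \<inter> (topspace X - k ` Q)"
        using Q by blast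
      ultimately show ?thesis
        using False by (auto simp: closedin_subtopology)
    qed
    show "continuous_map (subtopology ?X' (?T b)) Y ((\<lambda>b. if b then q \<circ> k' else g) b)" for b
    proof (cases b)
      case True
      have "(topspace X - k ` Q) \<inter> k ` (?D - Q) = k ` (?D - Q)"
        using kQ top by blast
      moreover have "continuous_map (subtopology X (k ` (?D - Q))) (top_of_set (?D - Q)) k'"
        unfolding continuous_map_in_subtopology
      proof
        have "continuous_map (subtopology X (k ` ?D)) euclidean k'"
          using k' by (simp add: homeomorphic_maps_def continuous_map_in_subtopology)
        then show "continuous_map (subtopology X (k ` (?D - Q))) euclidean k'"
          by (rule continuous_map_from_subtopology_mono) auto
      qed (auto simp: kk)
      ultimately show ?thesis
        using True continuous_map_compose[OF _ q] by (simp add: subtopology_subtopology)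
    next
      case False
      have "(topspace X - k ` Q) \<inter> (topspace X - k ` ?R) = topspace X - k ` ?R"
        using Q by blast
      then show ?thesis
        using False g by (simp add: subtopology_subtopology)
    qed
    show "(if i then q \<circ> k' else g) x = (if j then q \<circ> k' else g) x"
      if "x \<in> topspace ?X' \<inter> ?T i \<inter> ?T j" for i j x
    proof -
      have "q z = g (k z)" if "z \<in> ?D" "k z \<notin> k ` ?R" for z
        using that qg by blast
      then show ?thesis
        using that kk by (cases i; cases j) (force simp: comp_def)+
    qed
    show "\<exists>j. j \<in> UNIV \<and> x \<in> ?T j \<and> f x = (if j then q \<circ> k' else g) x"
      if "x \<in> topspace ?X'" for x
    proof (cases "x \<in> k ` ?D")
      case True
      then show ?thesis
        using that kQ by (intro exI[of _ True]) (auto simp: f_def)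
    next
      case False
      then have "x \<in> topspace X - k ` ?R"
        using that half_disc_subsets(1) by auto
      then show ?thesis
        using False by (intro exI[of _ False]) (auto simp: f_def)
    qed
  qed
  then show thesis
    using that fk by (simp add: f_def)
qed

text \<open>A homeomorphism of the plane that moves \<open>z1\<close> to \<open>z2\<close> can be
  supported in the connected open set \<open>open_half_disc\<close>. The flat side lies outside the
  support, so boundary points stay fixed even if the chart meets the boundary.\<close>

lemma half_disc_chart_move:
  assumes k: "half_disc_chart X c r k" and H: "Hausdorff_space X"
    and z: "z1 \<in> open_half_disc c r" "z2 \<in> open_half_disc c r"
  obtains h where "continuous_map X X h" "h ` (topspace X - {k z1}) \<subseteq> topspace X - {k z2}"
    "\<And>x. x \<in> manifold_boundary 2 X \<Longrightarrow> h x = x"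
proof -
  let ?D = "half_disc c r" and ?O = "open_half_disc c r"
  have aff: "affine hull ?O = UNIV"
    using affine_hull_open[OF open_open_half_disc] z by blast
  obtain f g where fg: "homeomorphism UNIV UNIV f g" "f z1 = z2"
    and supp: "{x. \<not> (f x = x \<and> g x = x)} \<subseteq> ?O"
    by (rule homeomorphism_moving_point[of ?O UNIV z1 z2])
       (use z convex_connected[OF convex_open_half_disc] in \<open>auto simp: aff open_open_half_disc\<close>)
  have fD: "f z \<in> ?D" if "z \<in> ?D" for z
  proof (cases "f z = z")
    case False
    \<comment> \<open>By injectivity a moved point has a moved image, which therefore lies in the
      support as well.\<close>
    then have "f (f z) \<noteq> f z"
      using fg(1) by (metis homeomorphism_apply1 UNIV_I)
    then show ?thesis
      using supp half_disc_subsets(3) by blast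
  qed (use that in simp)
  have inj: "inj_on k ?D" and ck: "continuous_map (top_of_set ?D) X k" and
      bd: "\<And>z. z \<in> ?D \<Longrightarrow> k z \<in> manifold_boundary 2 X \<longleftrightarrow> Re z = 0"
    using k by (auto simp: half_disc_chart_def)
  have top: "k ` ?D \<subseteq> topspace X"
    using half_disc_chart_homeomorphic(2)[OF k H] closedin_subset by blast
  have "continuous_map (top_of_set ?D) (top_of_set ?D) f"
    using fD continuous_on_subset[OF homeomorphism_cont1[OF fg(1)]] by auto
  then have c: "continuous_map (top_of_set (?D - {})) X (k \<circ> f)"
    using continuous_map_compose[OF _ ck] by (metis Diff_empty)
  obtain h where h: "continuous_map (subtopology X (topspace X - k ` {})) X h"
    and hk: "\<And>z. z \<in> ?D \<Longrightarrow> h (k z) = (k \<circ> f) z"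
    and hid: "\<And>x. x \<notin> k ` ?D \<Longrightarrow> h x = id x"
  proof (rule half_disc_chart_gluing[OF k H _ c, where g = id])
    show "(k \<circ> f) z = id (k z)" if "z \<notin> rel_half_disc c r" for z
    proof -
      have "f z = z"
        using supp that half_disc_subsets(2) by blast
      then show ?thesis
        by simp
    qed
  qed auto
  show thesis
  proof
    show "continuous_map X X h"
      using h by simp
    show "h ` (topspace X - {k z1}) \<subseteq> topspace X - {k z2}"
    proof safe
      fix x assume x: "x \<in> topspace X"
      then show "h x \<in> topspace X"
        using h by (auto simp: continuous_map_def)
      assume hx: "h x = k z2" "x \<noteq> k z1"
      show False
      proof (cases "x \<in> k ` ?D")
        case True
        then obtain z where zz: "z \<in> ?D" "x = k z"
          by blast
        then have "k (f z) = k (f z1)"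
          using hx hk fg by simp
        moreover have "z1 \<in> ?D"
          using z half_disc_subsets(3) by blast
        ultimately have "f z = f z1"
          using inj fD zz(1) by (blast dest: inj_onD)
        then have "z = z1"
          using fg(1) by (metis homeomorphism_apply1 UNIV_I)
        then show False
          using hx zz by simp
      next
        case False
        then show False
          using hid[of x] hx z half_disc_subsets(3) by auto
      qed
    qed
    show "h x = x" if "x \<in> manifold_boundary 2 X" for x
    proof (cases "x \<in> k ` ?D")
      case True
      then obtain z where zz: "z \<in> ?D" "x = k z"
        by blast
      then have "Re z = 0"
        using bd that by blast
      then have "f z = z"
        using supp by (auto simp: open_half_disc_def)
      then show ?thesis
        using zz hk by simp
    qed (use hid in simp)
  qed
qed

text \<open>A self-map of a closed disc that fixes the boundary circle cannot miss an interior
  point. Releasing the flat side of a half disc removes this obstruction; the price is that boundary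
  points inside the chart are moved.\<close>

lemma half_disc_chart_push:
  assumes k: "half_disc_chart X c r k" and H: "Hausdorff_space X" and c: "Re c = 0"
    and z: "z1 \<in> open_half_disc c r"
  obtains h where "continuous_map X X h" "h ` topspace X \<subseteq> topspace X - {k z1}"
    "\<And>x. x \<in> manifold_boundary 2 X \<Longrightarrow> x \<notin> k ` half_disc c r \<Longrightarrow> h x = x"
proof -
  let ?D = "half_disc c r"
  have inj: "inj_on k ?D" and ck: "continuous_map (top_of_set ?D) X k" and r: "0 < r"
    using k by (auto simp: half_disc_chart_def)
  \<comment> \<open>\<open>f\<close> fixes the round part of the boundary of the half disc and misses the point \<open>c + r / 4\<close>.\<close>
  define f where "f z = z + of_real ((r - cmod (z - c)) / 2)" for z
  have "continuous_on ?D f"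
    unfolding f_def by (intro continuous_intros) simp
  moreover have fD: "f z \<in> ?D" if "z \<in> ?D" for z
  proof -
    have z: "cmod (z - c) \<le> r" "0 \<le> Re z"
      using that by (auto simp: half_disc_def dist_norm norm_minus_commute)
    have "cmod (f z - c) = cmod ((z - c) + of_real ((r - cmod (z - c)) / 2))"
      by (simp add: f_def algebra_simps)
    also have "\<dots> \<le> cmod (z - c) + cmod (of_real ((r - cmod (z - c)) / 2))"
      by (rule norm_triangle_ineq)
    also have "cmod (of_real ((r - cmod (z - c)) / 2)) = (r - cmod (z - c)) / 2"
      using z unfolding norm_of_real by simp
    finally have "cmod (f z - c) \<le> r"
      using z by argo
    moreover have "0 \<le> Re (f z)"
      using z by (simp add: f_def)
    ultimately show ?thesis
      by (simp add: half_disc_def dist_norm norm_minus_commute)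
  qed
  ultimately have "continuous_map (top_of_set ?D) (top_of_set ?D) f"
    by auto
  then have cf: "continuous_map (top_of_set (?D - {})) X (k \<circ> f)"
    using continuous_map_compose[OF _ ck] by (metis Diff_empty)
  obtain h where h: "continuous_map (subtopology X (topspace X - k ` {})) X h"
    and hk: "\<And>z. z \<in> ?D \<Longrightarrow> h (k z) = (k \<circ> f) z"
    and hid: "\<And>x. x \<notin> k ` ?D \<Longrightarrow> h x = id x"
  proof (rule half_disc_chart_gluing[OF k H _ cf, where g = id])
    show "(k \<circ> f) z = id (k z)" if "z \<in> ?D" "z \<notin> rel_half_disc c r" for z
      using that by (auto simp: f_def half_disc_def rel_half_disc_def dist_norm norm_minus_commute)
  qed auto
  define z2 where "z2 = c + of_real (r / 4)"
  have z2: "z2 \<in> open_half_disc c r"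
    using r c by (auto simp: z2_def open_half_disc_def dist_norm)
  then have z2D: "z2 \<in> ?D"
    using half_disc_subsets(3) by blast
  \<comment> \<open>On the ray from \<open>c\<close> in the direction of the shift, \<open>f\<close>
    has real part \<open>(r + Re z) / 2 \<ge> r / 2\<close>, which exceeds \<open>r / 4\<close>; off
    this ray the imaginary part differs from that of \<open>c\<close>.\<close>
  have ne: "f z \<noteq> z2" if "z \<in> ?D" for z
  proof
    assume "f z = z2"
    then have e: "Im z = Im c" "Re z + (r - cmod (z - c)) / 2 = r / 4"
      using c by (auto simp: f_def z2_def complex_eq_iff)
    have "0 \<le> Re z"
      using that by (simp add: half_disc_def)
    moreover from this have "cmod (z - c) = Re z"
      using e c by (simp add: cmod_eq_Re)
    ultimately show False
      using e(2) r by argo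
  qed
  \<comment> \<open>The push misses one particular point; \<open>m\<close> trades it for the
    prescribed point \<open>k z1\<close>.\<close>
  obtain m where m: "continuous_map X X m" "m ` (topspace X - {k z2}) \<subseteq> topspace X - {k z1}"
    "\<And>x. x \<in> manifold_boundary 2 X \<Longrightarrow> m x = x"
    using half_disc_chart_move[OF k H z2 z] by blast
  show thesis
  proof
    show "continuous_map X X (m \<circ> h)"
      using h m(1) continuous_map_compose by auto
    have "h x \<in> topspace X - {k z2}" if x: "x \<in> topspace X" for x
    proof -
      have "h x \<noteq> k z2"
      proof (cases "x \<in> k ` ?D")
        case True
        then obtain z where zz: "z \<in> ?D" "x = k z"
          by blast
        then show ?thesis
          using hk ne fD inj z2D by (auto dest!: inj_onD)
      next
        case False
        then show ?thesis
          using hid z2D by auto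
      qed
      then show ?thesis
        using x h by (auto simp: continuous_map_def)
    qed
    then show "(m \<circ> h) ` topspace X \<subseteq> topspace X - {k z1}"
      using m(2) by (auto simp: image_subset_iff)
    show "(m \<circ> h) x = x" if "x \<in> manifold_boundary 2 X" "x \<notin> k ` half_disc c r" for x
      using that hid m(3) by simp
  qed
qed

subsection \<open>Maps from a surface to the circle\<close>

definition boundary_circles :: "'a topology \<Rightarrow> 'a set set" where
  "boundary_circles X = connected_components_of (subtopology X (manifold_boundary 2 X))"

lemma manifold_boundary_subset: "manifold_boundary n X \<subseteq> topspace X"
  by (auto simp: manifold_boundary_def)

lemma boundary_circles_subset:
  assumes "C \<in> boundary_circles X"
  shows "C \<subseteq> manifold_boundary 2 X"
  using connected_components_of_subset assms unfolding boundary_circles_def by fastforce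

lemma half_disc_chart_interior:
  assumes "half_disc_chart X c r k" "z \<in> half_disc c r"
  shows "k z \<in> manifold_interior 2 X \<longleftrightarrow> 0 < Re z"
proof -
  have "k z \<in> topspace X"
    using assms by (auto simp: half_disc_chart_def continuous_map_def)
  then have "k z \<in> manifold_interior 2 X \<longleftrightarrow> Re z \<noteq> 0"
    using assms by (auto simp: half_disc_chart_def manifold_boundary_def)
  moreover have "0 \<le> Re z"
    using assms by (simp add: half_disc_def)
  ultimately show ?thesis
    by auto
qed

lemma half_disc_chart_centre:
  assumes "half_disc_chart X c r k"
  shows "c \<in> rel_half_disc c r" "c \<in> half_disc c r"
  using assms by (auto simp: half_disc_chart_def rel_half_disc_def half_disc_def)

text \<open>The flat side is convex, so its image is a connected set of boundary points through
  \<open>k c\<close>. Hence a chart centred on \<open>C\<close> meets no other boundary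
  circle.\<close>

lemma half_disc_chart_component:
  assumes k: "half_disc_chart X c r k" and C: "C \<in> boundary_circles X" "k c \<in> C"
    and z: "z \<in> half_disc c r" "Re z = 0"
  shows "k z \<in> C"
proof -
  let ?F = "half_disc c r \<inter> {z. Re z = 0}"
  have "Re c = 0"
    using k C boundary_circles_subset half_disc_chart_centre(2)[OF k] by (auto simp: half_disc_chart_def)
  then have c: "c \<in> ?F"
    using half_disc_chart_centre(2)[OF k] by simp
  have "convex {z. Re z = 0}"
    using convex_hyperplane[of "1 :: complex" 0] by (simp add: inner_complex_def)
  then have "connected ?F"
    by (intro convex_connected convex_Int convex_half_disc)
  then have "connectedin (top_of_set (half_disc c r)) ?F"
    by (simp add: connectedin_subtopology)
  then have "connectedin X (k ` ?F)"
    using k by (auto simp: half_disc_chart_def intro: connectedin_continuous_map_image)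
  moreover have "k ` ?F \<subseteq> manifold_boundary 2 X"
    using k by (auto simp: half_disc_chart_def)
  ultimately have "connectedin (subtopology X (manifold_boundary 2 X)) (k ` ?F)"
    by (simp add: connectedin_subtopology)
  then have "k ` ?F \<subseteq> C"
    using C c unfolding boundary_circles_def by (intro connected_components_of_maximal) (auto simp: disjnt_iff)
  then show ?thesis
    using z by blast
qed

section \<open>Pushing the surface off an interior point\<close>

lemma manifold_interior_dense:
  assumes M: "manifold_with_boundary 2 X" and W: "openin X W" "x \<in> W"
  obtains y where "y \<in> W" "y \<in> manifold_interior 2 X"
proof -
  have "x \<in> topspace X"
    using W openin_subset by blast
  then obtain c r k where k: "half_disc_chart X c r k" "k c = x"
    using half_disc_chart_exists[OF M] by blast
  have r: "0 < r" and c: "0 \<le> Re c" and ck: "continuous_map (top_of_set (half_disc c r)) X k"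
    using k by (auto simp: half_disc_chart_def)
  have "openin (top_of_set (half_disc c r)) {z \<in> half_disc c r. k z \<in> W}"
    using openin_continuous_map_preimage[OF ck W(1)] by simp
  then obtain T where T: "open T" "{z \<in> half_disc c r. k z \<in> W} = half_disc c r \<inter> T"
    by (auto simp: openin_open)
  then have "c \<in> T"
    using half_disc_chart_centre(2)[OF k(1)] k(2) W(2) by blast
  then obtain e where e: "0 < e" "ball c e \<subseteq> T"
    using T open_contains_ball by blast
  \<comment> \<open>A shift to the right by half of the smaller radius enters the open half plane
    and stays inside both the chart and the ball contained in \<open>T\<close>.\<close>
  define z where "z = c + of_real (min e r / 2)"
  have d: "dist c z = min e r / 2"
    using e r by (simp add: z_def dist_norm)
  have zT: "z \<in> T"
    using d e r by (auto intro!: subsetD[OF e(2)])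
  have "0 < Re z"
    using c e r by (simp add: z_def)
  moreover have zD: "z \<in> half_disc c r"
    using d e r c by (auto simp: half_disc_def z_def)
  ultimately have "k z \<in> manifold_interior 2 X"
    using half_disc_chart_interior[OF k(1)] by blast
  moreover have "k z \<in> W"
    using zT zD T by blast
  ultimately show thesis
    using that by blast
qed

text \<open>Near \<open>C\<close> every interior point can be pushed off, and a homeomorphism supported in a half disc moves
  this property between any two interior points of a chart. As the charts at boundary points other than
  those of \<open>C\<close> are included, connectedness of \<open>X\<close> itself suffices.\<close>

lemma push_off_interior_point:
  assumes M: "manifold_with_boundary 2 X" and conn: "connected_space X"
    and C: "C \<in> boundary_circles X" and p: "p \<in> manifold_interior 2 X"
  obtains e where "continuous_map X X e" "e ` topspace X \<subseteq> topspace X - {p}"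
    "\<And>x. x \<in> manifold_boundary 2 X - C \<Longrightarrow> e x = x"
proof -
  have H: "Hausdorff_space X"
    using M by (simp add: manifold_with_boundary_def)
  define E where "E p \<longleftrightarrow> (\<exists>e. continuous_map X X e \<and> e ` topspace X \<subseteq> topspace X - {p} \<and>
    (\<forall>x\<in>manifold_boundary 2 X - C. e x = x))" for p
  let ?I = "manifold_interior 2 X"
  \<comment> \<open>\<open>G b\<close> consists of the points near which \<open>E\<close> has the
    constant truth value \<open>b\<close> at interior points. Both sets are open by definition;
    charts show that they cover \<open>X\<close>.\<close>
  define G where "G b = {x. \<exists>W. openin X W \<and> x \<in> W \<and> (\<forall>y\<in>W \<inter> ?I. E y = b)}" for b
  have move: "E (k z2)" if k: "half_disc_chart X c r k" and z: "z1 \<in> open_half_disc c r" "z2 \<in> open_half_disc c r"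
    and E1: "E (k z1)" for c r k z1 z2
  proof -
    obtain e where e: "continuous_map X X e" "e ` topspace X \<subseteq> topspace X - {k z1}"
      "\<forall>x\<in>manifold_boundary 2 X - C. e x = x"
      using E1 unfolding E_def by blast
    obtain h where h: "continuous_map X X h" "h ` (topspace X - {k z1}) \<subseteq> topspace X - {k z2}"
      "\<And>x. x \<in> manifold_boundary 2 X \<Longrightarrow> h x = x"
      by (rule half_disc_chart_move[OF k H z]) (rule that)
    show ?thesis
      unfolding E_def
    proof (intro exI[of _ "h \<circ> e"] conjI ballI)
      show "continuous_map X X (h \<circ> e)"
        using continuous_map_compose[OF e(1) h(1)] .
      show "(h \<circ> e) ` topspace X \<subseteq> topspace X - {k z2}"
        using e(2) h(2) by (force simp: image_subset_iff)
      show "(h \<circ> e) x = x" if "x \<in> manifold_boundary 2 X - C" for x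
        using that e(3) h(3) by simp
    qed
  qed
  have chart_interior: "\<exists>z\<in>open_half_disc c r. y = k z"
    if k: "half_disc_chart X c r k" and y: "y \<in> k ` rel_half_disc c r \<inter> ?I" for c r k y
  proof -
    obtain z where z: "z \<in> rel_half_disc c r" "y = k z"
      using y by blast
    then have "0 < Re z"
      using half_disc_chart_interior[OF k] half_disc_subsets(1) y by blast
    then show ?thesis
      using z by (auto simp: open_half_disc_def rel_half_disc_def)
  qed
  have open_G: "openin X (G b)" for b
  proof (subst openin_subopen, intro ballI)
    fix x assume "x \<in> G b"
    then obtain W where "openin X W" "x \<in> W" "\<forall>y\<in>W \<inter> ?I. E y = b"
      unfolding G_def by blast
    then show "\<exists>T. openin X T \<and> x \<in> T \<and> T \<subseteq> G b"
      unfolding G_def by blast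
  qed
  have cover: "topspace X \<subseteq> G True \<union> G False"
  proof
    fix x assume "x \<in> topspace X"
    then obtain c r k where k: "half_disc_chart X c r k" "k c = x"
      using half_disc_chart_exists[OF M] by blast
    have o: "openin X (k ` rel_half_disc c r)"
      using k by (simp add: half_disc_chart_def)
    have x: "x \<in> k ` rel_half_disc c r"
      using half_disc_chart_centre(1)[OF k(1)] k(2) by blast
    \<comment> \<open>All interior points of the chart neighbourhood come from
      \<open>open_half_disc\<close>, and \<open>move\<close> works between any two of them in both
      directions.\<close>
    have "\<exists>b. \<forall>y\<in>k ` rel_half_disc c r \<inter> ?I. E y = b"
      using move[OF k(1)] chart_interior[OF k(1)] by metis
    then obtain b where "x \<in> G b"
      using o x unfolding G_def by blast
    then show "x \<in> G True \<union> G False"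
      by (cases b) auto
  qed
  have disjoint: "G True \<inter> G False = {}"
  proof (rule ccontr)
    assume "G True \<inter> G False \<noteq> {}"
    then obtain x V W where "openin X V" "x \<in> V" "\<forall>y\<in>V \<inter> ?I. E y" "openin X W" "x \<in> W" "\<forall>y\<in>W \<inter> ?I. \<not> E y"
      unfolding G_def by auto
    \<comment> \<open>Without an interior point in every open set the conditions defining
      \<open>G True\<close> and \<open>G False\<close> could both hold vacuously.\<close>
    moreover then obtain y where "y \<in> V \<inter> W" "y \<in> ?I"
      using manifold_interior_dense[OF M, of "V \<inter> W" x] by (metis IntI openin_Int)
    ultimately show False
      by blast
  qed
  obtain x0 where x0: "x0 \<in> C"
    using C nonempty_connected_components_of unfolding boundary_circles_def by fastforce
  then have x0b: "x0 \<in> manifold_boundary 2 X"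
    using boundary_circles_subset[OF C] by blast
  then have "x0 \<in> topspace X"
    by (rule subsetD[OF manifold_boundary_subset])
  then obtain c r k where k: "half_disc_chart X c r k" "k c = x0"
    using half_disc_chart_exists[OF M] by blast
  have c: "Re c = 0"
    using k x0b half_disc_chart_centre(2)[OF k(1)] by (auto simp: half_disc_chart_def)
  have bd: "k z \<in> manifold_boundary 2 X \<longleftrightarrow> Re z = 0" if "z \<in> half_disc c r" for z
    using k that by (simp add: half_disc_chart_def)
  have "E (k z)" if z: "z \<in> open_half_disc c r" for z
  proof -
    obtain h where h: "continuous_map X X h" "h ` topspace X \<subseteq> topspace X - {k z}"
      "\<And>x. x \<in> manifold_boundary 2 X \<Longrightarrow> x \<notin> k ` half_disc c r \<Longrightarrow> h x = x"
      by (rule half_disc_chart_push[OF k(1) H c z]) (rule that)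
    have "x \<notin> k ` half_disc c r" if "x \<in> manifold_boundary 2 X - C" for x
      using half_disc_chart_component[OF k(1) C] that k(2) x0 bd by blast
    then have "h x = x" if "x \<in> manifold_boundary 2 X - C" for x
      using that h(3) by simp
    then show ?thesis
      unfolding E_def using h(1,2) by (intro exI[of _ h]) simp
  qed
  then have "E y" if "y \<in> k ` rel_half_disc c r \<inter> ?I" for y
    using chart_interior[OF k(1) that] by auto
  then have "\<forall>y\<in>k ` rel_half_disc c r \<inter> ?I. E y"
    by simp
  moreover have "openin X (k ` rel_half_disc c r)"
    using k by (simp add: half_disc_chart_def)
  moreover have "x0 \<in> k ` rel_half_disc c r"
    using half_disc_chart_centre(1)[OF k(1)] k(2) by blast
  ultimately have "x0 \<in> G True"
    unfolding G_def mem_Collect_eq by (intro exI[of _ "k ` rel_half_disc c r"]) simp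
  then have "G False = {}"
    using connected_spaceD[OF conn open_G open_G cover disjoint] by blast
  moreover have "p \<in> topspace X"
    using p by (simp add: manifold_interior_def)
  ultimately have "E p"
    using cover p unfolding G_def by blast
  then show thesis
    using that unfolding E_def by blast
qed

section \<open>Circle-valued maps with prescribed boundary values\<close>

lemma frontier_half_disc: "frontier (half_disc c r) = half_disc c r - open_half_disc c r"
proof -
  have "closed (half_disc c r)"
    by (simp add: compact_half_disc compact_imp_closed)
  moreover have "interior (half_disc c r) = open_half_disc c r"
    by (simp add: half_disc_def open_half_disc_def interior_right_half_plane)
  ultimately show ?thesis
    by (simp add: frontier_def)
qed

text \<open>The principal argument jumps at the negative reals; the factor \<open>- u\<close> moves
  this jump to \<open>w = u\<close>, so the angle is continuous on the circle without
  \<open>u\<close>, and the formula remains correct at \<open>u\<close> itself.\<close>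

lemma unit_circle_angle:
  fixes u w :: complex
  assumes "cmod u = 1" "cmod w = 1"
  shows "- u * cis (Arg (- (w / u))) = w"
proof -
  have "cis (Arg (- (w / u))) = - (w / u)"
    using assms by (subst cis_Arg) (auto simp: sgn_eq norm_divide)
  then show ?thesis
    using assms by auto
qed

text \<open>Outside a half disc meeting \<open>C\<close> in an arc, \<open>\<kappa>\<close> on the rest of \<open>C\<close> and the constant \<open>1\<close> on the other boundary
  circles have a continuous angle, which extends by Tietze's theorem. The punctured half disc retracts
  onto its boundary.\<close>

lemma punctured_circle_map:
  assumes M: "manifold_with_boundary 2 X" and comp: "compact_space X"
    and C: "C \<in> boundary_circles X" and clC: "closedin X (manifold_boundary 2 X - C)"
    and \<kappa>: "homeomorphic_map (subtopology X C) circle_topology \<kappa>"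
  obtains p f where "p \<in> manifold_interior 2 X"
    "continuous_map (subtopology X (topspace X - {p})) circle_topology f"
    "\<And>x. x \<in> C \<Longrightarrow> f x = \<kappa> x" "\<And>x. x \<in> manifold_boundary 2 X - C \<Longrightarrow> f x = 1"
proof -
  let ?B = "manifold_boundary 2 X"
  have H: "Hausdorff_space X"
    using M by (simp add: manifold_with_boundary_def)
  have CB: "C \<subseteq> ?B"
    by (rule boundary_circles_subset[OF C])
  have BX: "?B \<subseteq> topspace X"
    by (rule manifold_boundary_subset)
  have closed_C: "closedin X C"
    using C closedin_connected_components_of closedin_closed_subtopology[OF closedin_manifold_boundary]
    unfolding boundary_circles_def by blast
  obtain x0 where x0: "x0 \<in> C"
    using C nonempty_connected_components_of unfolding boundary_circles_def by fastforce
  then obtain c r k where k: "half_disc_chart X c r k" "k c = x0"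
    using half_disc_chart_exists[OF M] CB BX by blast
  let ?D = "half_disc c r" and ?R = "rel_half_disc c r"
  have r: "0 < r" and inj: "inj_on k ?D" and ck: "continuous_map (top_of_set ?D) X k"
    and bd: "\<And>z. z \<in> ?D \<Longrightarrow> k z \<in> ?B \<longleftrightarrow> Re z = 0"
    using k by (auto simp: half_disc_chart_def)
  have c: "Re c = 0"
    using bd half_disc_chart_centre(2)[OF k(1)] x0 k(2) CB by blast
  have flat: "k z \<in> C" if "z \<in> ?D" "Re z = 0" for z
    using half_disc_chart_component[OF k(1) C] that k(2) x0 by blast
  have CX: "topspace (subtopology X C) = C"
    using CB BX by auto
  have \<kappa>c: "continuous_map (subtopology X C) euclidean \<kappa>" and \<kappa>1: "\<And>x. x \<in> C \<Longrightarrow> cmod (\<kappa> x) = 1"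
    and \<kappa>i: "inj_on \<kappa> C"
    using \<kappa> CX homeomorphic_imp_continuous_map[OF \<kappa>] homeomorphic_imp_injective_map[OF \<kappa>]
    by (auto simp: circle_topology_def continuous_map_in_subtopology)
  define u where "u = \<kappa> x0"
  have u: "cmod u = 1"
    using \<kappa>1 x0 by (simp add: u_def)
  let ?C' = "C - k ` ?R"
  have oR: "openin X (k ` ?R)"
    using k by (simp add: half_disc_chart_def)
  have clC': "closedin X ?C'"
    using closed_C oR by (simp add: closedin_diff)
  \<comment> \<open>On \<open>A\<close> the angle is determined by the required boundary values. The
    arc of \<open>C\<close> in the chart is left out because it contains \<open>x0\<close>, at which
    the angle jumps.\<close>
  define A where "A = ?C' \<union> (?B - C)"
  \<comment> \<open>If \<open>u = 1\<close>, the constant value 1 gets its angle at the jump, which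
    does no harm on a piece where the angle is constant.\<close>
  define \<alpha> where "\<alpha> x = (if x \<in> C then Arg (- (\<kappa> x / u)) else Arg (- (1 / u)))" for x
  have clA: "closedin X A"
    unfolding A_def using clC' clC by blast
  have "continuous_map (subtopology X A) euclideanreal \<alpha>"
  proof (rule pasting_lemma_closed)
    let ?T = "\<lambda>b. if b then ?C' else ?B - C"
    show "finite (UNIV :: bool set)"
      by simp
    show "closedin (subtopology X A) (?T b)" for b
      using clC' clC clA by (auto simp: A_def closedin_closed_subtopology)
    show "continuous_map (subtopology (subtopology X A) (?T b)) euclideanreal
        ((\<lambda>b. if b then (\<lambda>x. Arg (- (\<kappa> x / u))) else (\<lambda>x. Arg (- (1 / u)))) b)" for b
    proof (cases b)
      case True
      have "x0 \<in> k ` ?R"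
        using half_disc_chart_centre(1)[OF k(1)] k(2) by blast
      then have ne: "\<kappa> x \<noteq> u" if "x \<in> ?C'" for x
        using that \<kappa>i x0 by (auto simp: u_def dest: inj_onD)
      have "continuous_map (subtopology X ?C') euclidean \<kappa>"
        by (rule continuous_map_from_subtopology_mono[OF \<kappa>c]) auto
      moreover have "(\<lambda>x. \<kappa> x) \<in> topspace (subtopology X ?C') \<rightarrow> sphere 0 1 - {u}"
        using ne \<kappa>1 by auto
      ultimately have "continuous_map (subtopology X ?C') (top_of_set (sphere 0 1 - {u})) \<kappa>"
        by (simp add: continuous_map_in_subtopology)
      moreover have "continuous_map (top_of_set (sphere 0 1 - {u})) euclideanreal (\<lambda>w. Arg (- (w / u)))"
      proof -
        have "- (w / u) \<notin> \<real>\<^sub>\<le>\<^sub>0" if "w \<in> sphere 0 1 - {u}" for w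
        proof
          assume "- (w / u) \<in> \<real>\<^sub>\<le>\<^sub>0"
          then obtain t where t: "- (w / u) = of_real t" "t \<le> 0"
            by (rule nonpos_Reals_cases)
          then have eq: "w / u = of_real (- t)"
            by (metis minus_minus of_real_minus)
          then have "cmod (w / u) = - t"
            using t(2) by simp
          moreover have "cmod (w / u) = 1"
            using that u by (simp add: norm_divide)
          ultimately have "w = u"
            using eq u by auto
          then show False
            using that by simp
        qed
        then show ?thesis
          by (auto intro!: continuous_intros) (use u in auto)
      qed
      ultimately have "continuous_map (subtopology X ?C') euclideanreal ((\<lambda>w. Arg (- (w / u))) \<circ> \<kappa>)"
        by (rule continuous_map_compose)
      moreover have "A \<inter> ?C' = ?C'"
        by (auto simp: A_def)
      ultimately show ?thesis
        using True by (simp add: subtopology_subtopology comp_def)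
    qed simp
    show "\<exists>j. j \<in> UNIV \<and> x \<in> ?T j \<and>
        \<alpha> x = (if j then (\<lambda>x. Arg (- (\<kappa> x / u))) else (\<lambda>x. Arg (- (1 / u)))) x"
      if "x \<in> topspace (subtopology X A)" for x
      using that by (intro exI[of _ "x \<in> C"]) (auto simp: A_def \<alpha>_def)
  qed (auto split: if_splits)
  \<comment> \<open>A circle-valued map on a closed set need not extend, but a real angle does,
    since the compact Hausdorff space \<open>X\<close> is normal.\<close>
  then obtain \<beta> where \<beta>: "continuous_map X euclideanreal \<beta>" "\<And>x. x \<in> A \<Longrightarrow> \<beta> x = \<alpha> x"
    using Tietze_extension_realinterval[OF compact_Hausdorff_or_regular_imp_normal_space[OF comp] clA, of UNIV \<alpha>] H
    by (metis UNIV_not_empty is_interval_univ subset_UNIV)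
  define g where "g x = - u * cis (\<beta> x)" for x
  have "continuous_map euclideanreal circle_topology (\<lambda>t. - u * cis t)"
    using u by (auto simp: circle_topology_def continuous_map_in_subtopology norm_mult intro!: continuous_intros)
  then have "continuous_map X circle_topology ((\<lambda>t. - u * cis t) \<circ> \<beta>)"
    using continuous_map_compose \<beta>(1) by blast
  then have gc: "continuous_map X circle_topology g"
    by (simp add: g_def[abs_def] comp_def)
  have g1: "g x = \<kappa> x" if "x \<in> ?C'" for x
    using that \<beta>(2)[of x] unit_circle_angle[OF u \<kappa>1] by (simp add: g_def A_def \<alpha>_def)
  have g2: "g x = 1" if "x \<in> ?B - C" for x
    using that \<beta>(2)[of x] unit_circle_angle[OF u, of 1] by (simp add: g_def A_def \<alpha>_def)
  define q where "q = c + of_real (r / 2)"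
  have q: "q \<in> open_half_disc c r"
    using r c by (auto simp: q_def open_half_disc_def dist_norm)
  let ?F = "frontier ?D"
  have fr: "?F = ?D - open_half_disc c r"
    by (rule frontier_half_disc)
  have aff: "affine hull ?D = UNIV"
    by (metis UNIV_I affine_hull_UNIV affine_hull_open[OF open_open_half_disc] q empty_iff half_disc_subsets(3) hull_mono top.extremum_uniqueI)
  have "q \<in> interior ?D"
    using q half_disc_subsets(3) open_open_half_disc interior_maximal by blast
  then have "q \<in> rel_interior ?D"
    using interior_subset_rel_interior by blast
  then have "rel_frontier ?D retract_of (affine hull ?D - {q})"
    by (intro rel_frontier_retract_of_punctured_affine_hull compact_imp_bounded compact_half_disc convex_half_disc)
  moreover have "rel_frontier ?D = ?F"
    using rel_frontier_frontier aff by blast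
  ultimately obtain \<rho> where \<rho>: "continuous_on (UNIV - {q}) \<rho>" "\<rho> \<in> (UNIV - {q}) \<rightarrow> ?F" "\<And>z. z \<in> ?F \<Longrightarrow> \<rho> z = z"
    unfolding aff retract_of_def retraction_def by auto
  \<comment> \<open>The intended values on the frontier of the half disc: \<open>\<kappa>\<close> on
    the flat side and \<open>g\<close> on the round arc. At the corners they agree, because these
    lie on the part of \<open>C\<close> where \<open>g\<close> already equals
    \<open>\<kappa>\<close>.\<close>
  define m where "m z = (if Re z = 0 then \<kappa> (k z) else g (k z))" for z
  have mg: "m z = g (k z)" if "z \<in> ?D" "z \<notin> ?R" for z
  proof (cases "Re z = 0")
    case True
    have "k z \<notin> k ` ?R"
      using that inj half_disc_subsets(1) by (auto dest: inj_onD)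
    then show ?thesis
      using True g1 flat that by (simp add: m_def)
  qed (simp add: m_def)
  have "continuous_map (top_of_set ?F) circle_topology m"
  proof (rule pasting_lemma_closed)
    let ?T = "\<lambda>b. if b then ?D \<inter> {z. Re z = 0} else ?D - ball c r"
    show "finite (UNIV :: bool set)"
      by simp
    show "closedin (top_of_set ?F) (?T b)" for b
    proof (rule closed_subset)
      show "?T b \<subseteq> ?F"
        by (auto simp: fr open_half_disc_def)
      have "closed {z. Re z = 0}"
        by (intro closed_Collect_eq continuous_intros)
      then show "closed (?T b)"
        using compact_imp_closed[OF compact_half_disc, of c r] by (auto intro: closed_Int closed_Diff)
    qed
    have sub: "?F \<inter> ?T b = ?T b" for b
      by (auto simp: fr open_half_disc_def)
    show "continuous_map (subtopology (top_of_set ?F) (?T b)) circle_topology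
        ((\<lambda>b. if b then \<kappa> \<circ> k else g \<circ> k) b)" for b
    proof (cases b)
      case True
      have "continuous_map (top_of_set (?D \<inter> {z. Re z = 0})) (subtopology X C) k"
        unfolding continuous_map_in_subtopology
        using continuous_map_from_subtopology_mono[OF ck, of "?D \<inter> {z. Re z = 0}"] flat by auto
      then have "continuous_map (top_of_set (?D \<inter> {z. Re z = 0})) circle_topology (\<kappa> \<circ> k)"
        using continuous_map_compose homeomorphic_imp_continuous_map[OF \<kappa>] by blast
      then show ?thesis
        using True sub[of True] by (simp add: subtopology_subtopology)
    next
      case False
      have "continuous_map (top_of_set (?D - ball c r)) X k"
        by (rule continuous_map_from_subtopology_mono[OF ck]) auto
      then have "continuous_map (top_of_set (?D - ball c r)) circle_topology (g \<circ> k)"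
        using continuous_map_compose gc by blast
      then show ?thesis
        using False sub[of False] by (simp add: subtopology_subtopology)
    qed
    have *: "\<kappa> (k z) = g (k z)" if "z \<in> ?D" "z \<notin> ball c r" "Re z = 0" for z
      using mg[of z] that by (simp add: m_def rel_half_disc_def)
    show "(if i then \<kappa> \<circ> k else g \<circ> k) z = (if j then \<kappa> \<circ> k else g \<circ> k) z"
      if "z \<in> topspace (top_of_set ?F) \<inter> ?T i \<inter> ?T j" for i j z
      using that *[of z] by (cases i; cases j) auto
    show "\<exists>j. j \<in> UNIV \<and> z \<in> ?T j \<and> m z = (if j then \<kappa> \<circ> k else g \<circ> k) z" if "z \<in> topspace (top_of_set ?F)" for z
    proof (cases "Re z = 0")
      case True
      then show ?thesis
        using that by (intro exI[of _ True]) (auto simp: fr m_def)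
    next
      case False
      have "z \<in> ?D" "z \<notin> open_half_disc c r"
        using that by (auto simp: fr)
      moreover from this have "0 < Re z"
        using False by (simp add: half_disc_def)
      ultimately show ?thesis
        by (intro exI[of _ False]) (auto simp: m_def open_half_disc_def)
    qed
  qed
  moreover have "continuous_map (top_of_set (?D - {q})) (top_of_set ?F) \<rho>"
    using \<rho>(2) continuous_on_subset[OF \<rho>(1), of "?D - {q}"] by (auto simp: continuous_map_in_subtopology)
  \<comment> \<open>A frontier map of nonzero winding number has no extension over the half disc;
    away from \<open>q\<close> the retraction supplies one.\<close>
  ultimately have mc: "continuous_map (top_of_set (?D - {q})) circle_topology (m \<circ> \<rho>)"
    using continuous_map_compose by blast
  have m\<rho>: "(m \<circ> \<rho>) z = m z" if "z \<in> ?D" "z \<notin> open_half_disc c r" for z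
    using that by (simp add: \<rho>(3) fr)
  have gr: "continuous_map (subtopology X (topspace X - k ` ?R)) circle_topology g"
    using gc by (rule continuous_map_from_subtopology)
  obtain f where f: "continuous_map (subtopology X (topspace X - k ` {q})) circle_topology f"
    and fk: "\<And>z. z \<in> ?D \<Longrightarrow> f (k z) = (m \<circ> \<rho>) z"
    and fg: "\<And>x. x \<notin> k ` ?D \<Longrightarrow> f x = g x"
  proof (rule half_disc_chart_gluing[OF k(1) H _ mc gr])
    show "{q} \<subseteq> ?R"
      using q half_disc_subsets(2) by blast
    show "(m \<circ> \<rho>) z = g (k z)" if "z \<in> ?D" "z \<notin> ?R" for z
    proof -
      have "z \<notin> open_half_disc c r"
        using that half_disc_subsets(2) by blast
      then show ?thesis
        using m\<rho> mg that by metis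
    qed
  qed (rule that)
  show thesis
  proof
    have qD: "q \<in> ?D"
      using q half_disc_subsets(3) by blast
    show "k q \<in> manifold_interior 2 X"
      using half_disc_chart_interior[OF k(1) qD] q by (simp add: open_half_disc_def)
    show "continuous_map (subtopology X (topspace X - {k q})) circle_topology f"
      using f by simp
    show "f x = \<kappa> x" if "x \<in> C" for x
    proof (cases "x \<in> k ` ?D")
      case True
      then obtain z where z: "z \<in> ?D" "x = k z"
        by blast
      then have "Re z = 0"
        using bd CB that by blast
      then show ?thesis
        using z fk m\<rho> by (simp add: m_def open_half_disc_def)
    next
      case False
      then have "x \<in> ?C'"
        using that half_disc_subsets(1) by blast
      then show ?thesis
        using g1 fg False by metis
    qed
    show "f x = 1" if "x \<in> ?B - C" for x
    proof -
      have "x \<notin> k ` ?D"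
        using that bd flat by blast
      then show ?thesis
        using fg g2 that by metis
    qed
  qed
qed

text \<open>The push \<open>e\<close> fixes \<open>C\<close> and all boundary circles except
  \<open>C'\<close>, so composing with it preserves the prescribed values there while the domain
  grows from the punctured surface to all of \<open>X\<close>.\<close>

lemma circle_map_separating_boundary_circles:
  assumes M: "manifold_with_boundary 2 X" and comp: "compact_space X" and conn: "connected_space X"
    and C: "C \<in> boundary_circles X" and clC: "closedin X (manifold_boundary 2 X - C)"
    and C': "C' \<in> boundary_circles X" "C' \<noteq> C"
    and \<kappa>: "homeomorphic_map (subtopology X C) circle_topology \<kappa>"
  obtains f where "continuous_map X circle_topology f" "\<And>x. x \<in> C \<Longrightarrow> f x = \<kappa> x"
    "\<And>x. x \<in> manifold_boundary 2 X \<Longrightarrow> x \<notin> C \<Longrightarrow> x \<notin> C' \<Longrightarrow> f x = 1"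
proof -
  obtain p f where p: "p \<in> manifold_interior 2 X"
    and f: "continuous_map (subtopology X (topspace X - {p})) circle_topology f"
    "\<And>x. x \<in> C \<Longrightarrow> f x = \<kappa> x" "\<And>x. x \<in> manifold_boundary 2 X - C \<Longrightarrow> f x = 1"
    by (rule punctured_circle_map[OF M comp C clC \<kappa>]) (rule that)
  obtain e where e: "continuous_map X X e" "e ` topspace X \<subseteq> topspace X - {p}"
    "\<And>x. x \<in> manifold_boundary 2 X - C' \<Longrightarrow> e x = x"
    by (rule push_off_interior_point[OF M conn C'(1) p]) (rule that)
  have "pairwise disjnt (boundary_circles X)"
    unfolding boundary_circles_def by (rule pairwise_disjoint_connected_components_of)
  then have "disjnt C C'"
    using C C' by (metis pairwiseD)
  then have "C \<subseteq> manifold_boundary 2 X - C'"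
    using boundary_circles_subset[OF C] by (auto simp: disjnt_iff)
  show thesis
  proof
    have "continuous_map X (subtopology X (topspace X - {p})) e"
      using e by (auto simp: continuous_map_in_subtopology)
    then show "continuous_map X circle_topology (f \<circ> e)"
      using f(1) continuous_map_compose by blast
    show "(f \<circ> e) x = \<kappa> x" if "x \<in> C" for x
      using that f(2) e(3)[of x] \<open>C \<subseteq> manifold_boundary 2 X - C'\<close> by (auto simp: comp_def)
    show "(f \<circ> e) x = 1" if "x \<in> manifold_boundary 2 X" "x \<notin> C" "x \<notin> C'" for x
      using that f(3)[of x] e(3)[of x] by simp
  qed
qed

subsection \<open>Integral combinations and bases\<close>

context comm_group
begin

lemma Z_combination_cong:
  assumes "b \<in> {..<k} \<rightarrow> carrier G" "\<And>i. i < k \<Longrightarrow> b i = b' i" "\<And>i. i < k \<Longrightarrow> c i = c' i"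
  shows "Z_combination G k b c = Z_combination G k b' c'"
  unfolding Z_combination_def using assms by (intro finprod_cong') (auto simp: Pi_iff)

lemma Z_combination_closed [simp]:
  assumes "b \<in> {..<k} \<rightarrow> carrier G"
  shows "Z_combination G k b c \<in> carrier G"
  unfolding Z_combination_def using assms by (intro finprod_closed) auto

lemma Z_combination_add:
  assumes "b \<in> {..<k} \<rightarrow> carrier G"
  shows "Z_combination G k b c \<otimes> Z_combination G k b d = Z_combination G k b (\<lambda>i. c i + d i)"
proof -
  have "Z_combination G k b c \<otimes> Z_combination G k b d = finprod G (\<lambda>i. b i [^] c i \<otimes> b i [^] d i) {..<k}"
    unfolding Z_combination_def using assms by (intro finprod_multf[symmetric]) auto
  also have "\<dots> = Z_combination G k b (\<lambda>i. c i + d i)"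
    unfolding Z_combination_def using assms by (intro finprod_cong') (auto simp: int_pow_mult Pi_iff)
  finally show ?thesis .
qed

lemma Z_combination_zero:
  assumes "\<And>i. i < k \<Longrightarrow> c i = 0"
  shows "Z_combination G k b c = \<one>"
  unfolding Z_combination_def using assms by (intro finprod_one_eqI) auto

lemma finprod_Z_combination:
  assumes "b \<in> {..<k} \<rightarrow> carrier G" "finite A"
  shows "finprod G (\<lambda>a. Z_combination G k b (c a)) A = Z_combination G k b (\<lambda>i. \<Sum>a\<in>A. c a i)"
  using assms(2)
proof (induction A rule: finite_induct)
  case empty
  then show ?case
    by (simp add: Z_combination_zero)
next
  case (insert a A)
  then show ?case
    using assms(1) by (subst finprod_insert) (auto simp: Z_combination_add)
qed

lemma Z_combination_pow:
  assumes "b \<in> {..<k} \<rightarrow> carrier G"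
  shows "Z_combination G k b c [^] (m :: int) = Z_combination G k b (\<lambda>i. c i * m)"
proof -
  have "finprod G f A [^] m = finprod G (\<lambda>i. f i [^] m) A" if "f \<in> A \<rightarrow> carrier G" "finite A"
    for f :: "nat \<Rightarrow> 'a" and A
    using that(2,1)
    by (induction A rule: finite_induct) (auto simp: int_pow_distrib Pi_iff)
  then have "Z_combination G k b c [^] m = finprod G (\<lambda>i. (b i [^] c i) [^] m) {..<k}"
    unfolding Z_combination_def using assms by (auto simp: Pi_iff)
  also have "\<dots> = Z_combination G k b (\<lambda>i. c i * m)"
    unfolding Z_combination_def using assms by (intro finprod_cong') (auto simp: int_pow_pow Pi_iff)
  finally show ?thesis .
qed

text \<open>Substituting combinations into combinations multiplies coefficient matrices; together
  with uniqueness of coordinates this yields every matrix identity between bases.\<close>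

lemma Z_combination_Z_combination:
  assumes "b \<in> {..<k} \<rightarrow> carrier G"
  shows "Z_combination G m (\<lambda>j. Z_combination G k b (c j)) d
    = Z_combination G k b (\<lambda>i. \<Sum>j<m. c j i * d j)"
proof -
  have "Z_combination G m (\<lambda>j. Z_combination G k b (c j)) d
      = finprod G (\<lambda>j. Z_combination G k b (\<lambda>i. c j i * d j)) {..<m}"
    unfolding Z_combination_def[of G m] using assms
    by (intro finprod_cong') (auto simp: Z_combination_pow)
  then show ?thesis
    using assms by (simp add: finprod_Z_combination)
qed

lemma Z_combination_unit:
  assumes "b \<in> {..<k} \<rightarrow> carrier G" "j < k"
  shows "Z_combination G k b (\<lambda>i. of_bool (i = j)) = b j"
proof -
  have "Z_combination G k b (\<lambda>i. of_bool (i = j)) = finprod G (\<lambda>i. if j = i then b i else \<one>) {..<k}"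
    unfolding Z_combination_def using assms by (intro finprod_cong') (auto simp: Pi_iff)
  also have "\<dots> = b j"
    using assms by (intro finprod_singleton) auto
  finally show ?thesis .
qed

lemma Z_combination_Suc:
  assumes "b \<in> {..<Suc k} \<rightarrow> carrier G"
  shows "Z_combination G (Suc k) b c = b 0 [^] c 0 \<otimes> Z_combination G k (\<lambda>i. b (Suc i)) (\<lambda>i. c (Suc i))"
proof -
  have "Z_combination G (Suc k) b c = b 0 [^] c 0 \<otimes> finprod G (\<lambda>i. b i [^] c i) (Suc ` {..<k})"
    unfolding Z_combination_def lessThan_Suc_eq_insert_0
    using assms by (intro finprod_insert) auto
  also have "finprod G (\<lambda>i. b i [^] c i) (Suc ` {..<k}) = Z_combination G k (\<lambda>i. b (Suc i)) (\<lambda>i. c (Suc i))"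
    unfolding Z_combination_def using assms by (subst finprod_reindex) auto
  finally show ?thesis .
qed

text \<open>\<open>is_Z_basis\<close> asserts uniqueness only among coefficient functions that are
  \<open>undefined\<close> outside \<open>{..<k}\<close>, so arbitrary ones are restricted before
  they are compared.\<close>

lemma Z_basis_coeffs_unique:
  assumes B: "is_Z_basis G k b" and eq: "Z_combination G k b c = Z_combination G k b d" and "i < k"
  shows "c i = d i"
proof -
  have b: "b \<in> {..<k} \<rightarrow> carrier G"
    using B by (simp add: is_Z_basis_def)
  have r: "Z_combination G k b (restrict e {..<k}) = Z_combination G k b e" for e
    by (rule Z_combination_cong[OF b]) auto
  have "\<exists>!e. e \<in> {..<k} \<rightarrow>\<^sub>E UNIV \<and> Z_combination G k b c = Z_combination G k b e"
    using B b by (simp add: is_Z_basis_def)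
  moreover have "restrict c {..<k} \<in> {..<k} \<rightarrow>\<^sub>E UNIV" "restrict d {..<k} \<in> {..<k} \<rightarrow>\<^sub>E UNIV"
    by auto
  ultimately have "restrict c {..<k} = restrict d {..<k}"
    using r eq by metis
  then show ?thesis
    using \<open>i < k\<close> by (metis lessThan_iff restrict_apply')
qed

end

text \<open>The description has the same form as the one in \<open>gluing_matrix\<close>, which thus
  becomes a matrix of coordinates with respect to the transported basis.\<close>

definition Z_coords :: "('g, 'm) monoid_scheme \<Rightarrow> nat \<Rightarrow> (nat \<Rightarrow> 'g) \<Rightarrow> 'g \<Rightarrow> nat \<Rightarrow> int" where
  "Z_coords G k b x = (THE c. c \<in> {..<k} \<rightarrow>\<^sub>E UNIV \<and> x = Z_combination G k b c)"

lemma Z_combination_Z_coords: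
  assumes "is_Z_basis G k b" "x \<in> carrier G"
  shows "Z_combination G k b (Z_coords G k b x) = x"
proof -
  have "\<exists>!c. c \<in> {..<k} \<rightarrow>\<^sub>E UNIV \<and> x = Z_combination G k b c"
    using assms by (simp add: is_Z_basis_def)
  from conjunct2[OF theI'[OF this]] show ?thesis
    unfolding Z_coords_def by (rule sym)
qed

lemma (in comm_group) Z_coords_eq:
  assumes "is_Z_basis G k b" "x = Z_combination G k b c" "i < k"
  shows "Z_coords G k b x i = c i"
proof -
  have "x \<in> carrier G"
    using assms by (simp add: is_Z_basis_def)
  then have "Z_combination G k b (Z_coords G k b x) = Z_combination G k b c"
    using Z_combination_Z_coords assms by metis
  then show ?thesis
    using Z_basis_coeffs_unique assms by blast
qed

lemma hom_finprod:
  assumes G: "comm_group G" and H: "comm_group H" and h: "h \<in> hom G H" and "finite A" and "f \<in> A \<rightarrow> carrier G"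
  shows "h (finprod G f A) = finprod H (\<lambda>a. h (f a)) A"
  using assms(4,5)
proof (induction A rule: finite_induct)
  case empty
  then show ?case
    using hom_one[OF h] G H by (simp add: comm_group_def comm_monoid.finprod_empty)
next
  case (insert a A)
  have hc: "\<And>x. x \<in> carrier G \<Longrightarrow> h x \<in> carrier H"
    using h by (auto simp: hom_def)
  have f: "f a \<in> carrier G" "f \<in> A \<rightarrow> carrier G"
    using insert.prems by auto
  have m: "comm_monoid G" "comm_monoid H"
    using G H by (simp_all add: comm_group_def)
  have "h (finprod G f (insert a A)) = h (f a \<otimes>\<^bsub>G\<^esub> finprod G f A)"
    using insert.hyps f by (simp add: comm_monoid.finprod_insert[OF m(1)])
  also have "\<dots> = h (f a) \<otimes>\<^bsub>H\<^esub> h (finprod G f A)"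
    by (rule hom_mult[OF h f(1) comm_monoid.finprod_closed[OF m(1) f(2)]])
  also have "\<dots> = finprod H (\<lambda>a. h (f a)) (insert a A)"
    using insert.hyps insert.IH[OF f(2)] f hc
    by (subst comm_monoid.finprod_insert[OF m(2)]) auto
  finally show ?case .
qed

lemma hom_Z_combination:
  assumes G: "comm_group G" and H: "comm_group H" and h: "h \<in> hom G H" and b: "b \<in> {..<k} \<rightarrow> carrier G"
  shows "h (Z_combination G k b c) = Z_combination H k (\<lambda>i. h (b i)) c"
proof -
  have g: "group G" "group H"
    using G H by (simp_all add: comm_group_def)
  have "h (Z_combination G k b c) = finprod H (\<lambda>i. h (b i [^]\<^bsub>G\<^esub> c i)) {..<k}"
    unfolding Z_combination_def using b by (intro hom_finprod[OF G H h]) (auto intro: group.int_pow_closed[OF g(1)])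
  also have "\<dots> = Z_combination H k (\<lambda>i. h (b i)) c"
    unfolding Z_combination_def
  proof (rule comm_monoid.finprod_cong')
    show "comm_monoid H"
      using H by (simp add: comm_group_def)
    show "(\<lambda>i. h (b i) [^]\<^bsub>H\<^esub> c i) \<in> {..<k} \<rightarrow> carrier H"
      using b h by (auto intro!: group.int_pow_closed[OF g(2)] simp: hom_def)
    show "h (b i [^]\<^bsub>G\<^esub> c i) = h (b i) [^]\<^bsub>H\<^esub> c i" if "i \<in> {..<k}" for i
      using b that by (intro hom_int_pow[OF h _ g]) auto
  qed simp
  finally show ?thesis .
qed

lemma is_Z_basis_iso:
  assumes G: "comm_group G" and H: "comm_group H" and h: "h \<in> iso G H" and B: "is_Z_basis G k b"
  shows "is_Z_basis H k (\<lambda>i. h (b i))"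
proof -
  have hh: "h \<in> hom G H" and bij: "bij_betw h (carrier G) (carrier H)"
    using h by (auto simp: iso_def)
  have b: "b \<in> {..<k} \<rightarrow> carrier G" and B': "\<And>x. x \<in> carrier G \<Longrightarrow>
      \<exists>!c. c \<in> {..<k} \<rightarrow>\<^sub>E UNIV \<and> x = Z_combination G k b c"
    using B by (auto simp: is_Z_basis_def)
  have eq: "Z_combination H k (\<lambda>i. h (b i)) c = h (Z_combination G k b c)" for c
    using hom_Z_combination[OF G H hh b] by simp
  show ?thesis
    unfolding is_Z_basis_def eq
  proof (intro conjI ballI)
    show "(\<lambda>i. h (b i)) \<in> {..<k} \<rightarrow> carrier H"
      using b hh by (auto simp: hom_def)
    fix y assume "y \<in> carrier H"
    then obtain x where x: "x \<in> carrier G" "y = h x"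
      using bij by (auto simp: bij_betw_def)
    have "y = h (Z_combination G k b c) \<longleftrightarrow> x = Z_combination G k b c" for c
      using x bij comm_group.Z_combination_closed[OF G b, of c] by (auto simp: bij_betw_def inj_on_def)
    then show "\<exists>!c. c \<in> {..<k} \<rightarrow>\<^sub>E UNIV \<and> y = h (Z_combination G k b c)"
      using B'[OF x(1)] by simp
  qed
qed

subsection \<open>First homology of the circle\<close>

abbreviation H1 :: "'a topology \<Rightarrow> 'a chain set monoid" where
  "H1 X \<equiv> homology_group 1 X"

abbreviation H1_map :: "'a topology \<Rightarrow> 'b topology \<Rightarrow> ('a \<Rightarrow> 'b) \<Rightarrow> 'a chain set \<Rightarrow> 'b chain set" where
  "H1_map X Y \<equiv> hom_induced 1 X {} Y {}"

lemma group_H1 [simp]: "group (H1 X)" "comm_monoid (H1 X)"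
  using abelian_homology_group[of 1 X] by (simp_all add: comm_group_def)

lemma H1_map_in_carrier [simp]: "H1_map X Y h a \<in> carrier (H1 Y)"
  by (rule hom_induced_carrier)

text \<open>The composite \<open>k\<close> is prescribed only on \<open>topspace X\<close>, because
  the projections and inclusions of a block have known formulas only there.\<close>

lemma H1_map_compose:
  assumes "continuous_map X Y g" "continuous_map Y Z h" "\<And>x. x \<in> topspace X \<Longrightarrow> k x = h (g x)"
  shows "H1_map Y Z h (H1_map X Y g a) = H1_map X Z k a"
proof -
  have "H1_map Y Z h (H1_map X Y g a) = H1_map X Z (h \<circ> g) a"
    using hom_induced_compose'[OF assms(1) _ assms(2)] by (simp add: Pi_iff)
  also have "H1_map X Z (h \<circ> g) = H1_map X Z k"
    using assms(3) by (intro hom_induced_eq) simp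
  finally show ?thesis .
qed

lemma H1_map_id:
  assumes "a \<in> carrier (H1 X)" "\<And>x. x \<in> topspace X \<Longrightarrow> g x = x"
  shows "H1_map X X g a = a"
proof -
  have "H1_map X X g = H1_map X X id"
    using assms(2) by (intro hom_induced_eq) simp
  then show ?thesis
    using hom_induced_id[OF assms(1)] by simp
qed

text \<open>A constant map factors through a one-point space, whose first homology vanishes by the
  dimension axiom.\<close>

lemma H1_map_const:
  assumes "\<And>x. x \<in> topspace X \<Longrightarrow> g x = y" "y \<in> topspace Y"
  shows "H1_map X Y g a = \<one>\<^bsub>H1 Y\<^esub>"
proof -
  let ?P = "discrete_topology {y}"
  have "H1_map ?P Y id (H1_map X ?P (\<lambda>_. y) a) = H1_map X Y g a"
    using assms by (intro H1_map_compose) auto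
  moreover have "trivial_group (H1 ?P)"
    by (rule homology_dimension_axiom) auto
  then have "H1_map X ?P (\<lambda>_. y) a = \<one>\<^bsub>H1 ?P\<^esub>"
    using H1_map_in_carrier[of X ?P "\<lambda>_. y" a] unfolding trivial_group_def by blast
  moreover have "H1_map ?P Y id \<one>\<^bsub>H1 ?P\<^esub> = \<one>\<^bsub>H1 Y\<^esub>"
    by (rule hom_one[OF hom_induced_empty_hom]) simp_all
  ultimately show ?thesis
    by simp
qed

lemma circle_homeomorphic_nsphere: "circle_topology homeomorphic_space nsphere 1"
proof -
  have "homeomorphic_maps (subtopology (Euclidean_space 2) {x. (\<Sum>i\<le>1. x i ^ 2) = 1})
      (subtopology euclidean (sphere 0 1)) complex_of_plane plane_of_complex"
    by (rule homeomorphic_maps_subtopologies_alt[OF homeomorphic_maps_plane_complex])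
       (auto simp: complex_of_plane_def plane_of_complex_def cmod_def)
  then show ?thesis
    unfolding circle_topology_def nsphere_def numeral_2_eq_2[symmetric] One_nat_def[symmetric]
    using homeomorphic_space_def homeomorphic_space_sym by (metis Suc_1)
qed

lemma H1_circle_iso: "H1 circle_topology \<cong> integer_group"
proof -
  have "H1 circle_topology \<cong> H1 (nsphere 1)"
    by (rule homeomorphic_space_imp_isomorphic_homology_groups[OF circle_homeomorphic_nsphere])
  moreover have "H1 (nsphere 1) \<cong> integer_group"
    using reduced_homology_group_nsphere(1)[of 1] by (simp add: un_reduced_homology_group)
  ultimately show ?thesis
    by (rule iso_trans)
qed

text \<open>Opposite signs on two tori of one block would produce a nontrivial class whose square is
  trivial; this excludes it.\<close>

lemma H1_circle_no_2_torsion: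
  assumes "a \<in> carrier (H1 circle_topology)" "a \<otimes>\<^bsub>H1 circle_topology\<^esub> a = \<one>\<^bsub>H1 circle_topology\<^esub>"
  shows "a = \<one>\<^bsub>H1 circle_topology\<^esub>"
proof -
  obtain h where h: "h \<in> iso (H1 circle_topology) integer_group"
    using H1_circle_iso unfolding is_iso_def by blast
  then have hh: "h \<in> hom (H1 circle_topology) integer_group" and inj: "inj_on h (carrier (H1 circle_topology))"
    by (auto simp: iso_def bij_betw_def)
  have one: "h \<one>\<^bsub>H1 circle_topology\<^esub> = 0"
    using hom_one[OF hh] by simp
  have "h a + h a = 0"
    using hom_mult[OF hh assms(1,1)] assms(2) one by simp
  then have "h a = h \<one>\<^bsub>H1 circle_topology\<^esub>"
    using one by simp
  then show ?thesis
    by (rule inj_onD[OF inj]) (simp_all add: assms(1) monoid.one_closed[OF group.is_monoid[OF group_H1(1)]])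
qed

lemma H1_circle_nontrivial:
  obtains a where "a \<in> carrier (H1 circle_topology)" "a \<noteq> \<one>\<^bsub>H1 circle_topology\<^esub>"
proof -
  obtain h where h: "h \<in> iso (H1 circle_topology) integer_group"
    using H1_circle_iso unfolding is_iso_def by blast
  then have hh: "h \<in> hom (H1 circle_topology) integer_group" and im: "h ` carrier (H1 circle_topology) = UNIV"
    by (auto simp: iso_def bij_betw_def)
  then obtain a where a: "a \<in> carrier (H1 circle_topology)" "h a = 1"
    by (metis UNIV_I imageE)
  then have "a \<noteq> \<one>\<^bsub>H1 circle_topology\<^esub>"
    using hom_one[OF hh] by auto
  then show thesis
    using a that by blast
qed

text \<open>Each component is closed, but their union is only known to be closed if there are
  finitely many.\<close>

lemma boundary_circle_complement_closed:
  assumes "finite (boundary_circles X)" "C \<in> boundary_circles X"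
  shows "closedin X (manifold_boundary 2 X - C)"
proof -
  have cl: "closedin X C'" if "C' \<in> boundary_circles X" for C'
    using that closedin_connected_components_of closedin_closed_subtopology[OF closedin_manifold_boundary]
    unfolding boundary_circles_def by blast
  have "pairwise disjnt (boundary_circles X)"
    unfolding boundary_circles_def by (rule pairwise_disjoint_connected_components_of)
  moreover have "\<Union> (boundary_circles X) = manifold_boundary 2 X"
    unfolding boundary_circles_def Union_connected_components_of
    using manifold_boundary_subset[of 2 X] by auto
  ultimately have "manifold_boundary 2 X - C = \<Union> (boundary_circles X - {C})"
    using assms(2) by (auto simp: pairwise_def disjnt_iff)
  also have "closedin X \<dots>"
    using assms(1) cl by (intro closedin_Union) auto
  finally show ?thesis .
qed

subsection \<open>Ranks of linear forms and congruence of matrices\<close>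

interpretation forms: vector_space "\<lambda>r (e :: ('x \<Rightarrow> real) \<Rightarrow> real) a. r * e a"
  by unfold_locales (auto simp: fun_eq_iff algebra_simps)

interpretation forms_pair: vector_space_pair
  "\<lambda>r (e :: ('x \<Rightarrow> real) \<Rightarrow> real) a. r * e a" "\<lambda>r (e :: ('x \<Rightarrow> real) \<Rightarrow> real) a. r * e a"
  by unfold_locales

text \<open>The operations on forms are pointwise, so composition with any map \<open>T\<close> of
  assignments is linear in the form.\<close>

lemma linear_pullback:
  "Vector_Spaces.linear (\<lambda>r (e :: ('x \<Rightarrow> real) \<Rightarrow> real) a. r * e a) (\<lambda>r (e :: ('x \<Rightarrow> real) \<Rightarrow> real) a. r * e a)
     (\<lambda>e. e \<circ> T)"
  by unfold_locales (auto simp: fun_eq_iff)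

text \<open>Pullback along \<open>T\<close> sends a basis chosen from \<open>E'\<close> into the
  span of \<open>E\<close>, and pullback along \<open>T'\<close> is a left inverse on its span, so
  independence is preserved. The inverse property is stated for the forms in \<open>E'\<close>,
  since \<open>T\<close> and \<open>T'\<close> will be inverse only on the values that these forms
  see.\<close>

lemma rank_of_forms_le:
  fixes E E' :: "(('x \<Rightarrow> real) \<Rightarrow> real) set"
  assumes fin: "finite E" and sp: "\<And>e. e \<in> E' \<Longrightarrow> e \<circ> T \<in> forms.span E"
    and inv: "\<And>e. e \<in> E' \<Longrightarrow> e \<circ> T \<circ> T' = e"
  shows "rank_of_forms E' \<le> rank_of_forms E"
proof -
  obtain B where B: "B \<subseteq> E'" "forms.independent B" "card B = forms.dim E'"
    using forms.basis_exists[of E'] by metis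
  obtain C where C: "C \<subseteq> E" "E \<subseteq> forms.span C" "card C = forms.dim E"
    using forms.basis_exists[of E] by metis
  have "(e \<circ> T) \<circ> T' = e" if "e \<in> forms.span B" for e
  proof (rule forms_pair.linear_eq_on[OF _ _ that])
    show "Vector_Spaces.linear (\<lambda>r (e :: ('x \<Rightarrow> real) \<Rightarrow> real) a. r * e a) (\<lambda>r (e :: ('x \<Rightarrow> real) \<Rightarrow> real) a. r * e a) (\<lambda>e. (e \<circ> T) \<circ> T')"
      using linear_pullback[of "T \<circ> T'"] by (simp add: comp_assoc)
    show "Vector_Spaces.linear (\<lambda>r (e :: ('x \<Rightarrow> real) \<Rightarrow> real) a. r * e a) (\<lambda>r (e :: ('x \<Rightarrow> real) \<Rightarrow> real) a. r * e a) (\<lambda>e. e)"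
      using linear_pullback[of id] by simp
    show "(b \<circ> T) \<circ> T' = b" if "b \<in> B" for b
      using inv[of b] B(1) that by blast
  qed
  then have inj: "inj_on (\<lambda>e. e \<circ> T) (forms.span B)"
    by (rule inj_on_inverseI[where g = "\<lambda>e. e \<circ> T'"])
  have "forms.independent ((\<lambda>e. e \<circ> T) ` B)"
    by (rule forms_pair.linear_independent_injective_image[OF linear_pullback B(2) inj])
  moreover have "(\<lambda>e. e \<circ> T) ` B \<subseteq> forms.span C"
    using sp B(1) forms.span_mono[OF C(2)] by (auto simp: forms.span_span)
  moreover have "finite C"
    using C(1) fin finite_subset by blast
  ultimately have "card ((\<lambda>e. e \<circ> T) ` B) \<le> card C"
    using forms.independent_span_bound by blast
  moreover have "card ((\<lambda>e. e \<circ> T) ` B) = card B"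
    by (intro card_image inj_on_subset[OF inj] forms.span_superset)
  ultimately show ?thesis
    by (simp add: rank_of_forms_def B C)
qed

section \<open>Congruence of matrices\<close>

definition congruence_transform :: "nat \<Rightarrow> (nat \<Rightarrow> nat \<Rightarrow> real) \<Rightarrow> (nat \<Rightarrow> nat \<Rightarrow> real) \<Rightarrow> nat \<Rightarrow> nat \<Rightarrow> real" where
  "congruence_transform m P G i j = (\<Sum>k<m. \<Sum>l<m. P k i * G k l * P l j)"

lemma congruence_transform_cong:
  assumes "\<And>k. k < m \<Longrightarrow> P k i = P' k i" "\<And>k. k < m \<Longrightarrow> P k j = P' k j"
    "\<And>k l. k < m \<Longrightarrow> l < m \<Longrightarrow> G k l = G' k l"
  shows "congruence_transform m P G i j = congruence_transform m P' G' i j"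
  unfolding congruence_transform_def using assms by (intro sum.cong) auto

text \<open>The rule \<open>Q\<^sup>T (P\<^sup>T G P) Q = (P Q)\<^sup>T G (P Q)\<close>, proved by
  interchanging the four summations.\<close>

lemma congruence_transform_transform:
  "congruence_transform m Q (congruence_transform m P G) i j
    = congruence_transform m (\<lambda>k l. \<Sum>h<m. P k h * Q h l) G i j"
proof -
  have "congruence_transform m Q (congruence_transform m P G) i j
      = (\<Sum>h<m. \<Sum>h'<m. \<Sum>k<m. \<Sum>l<m. Q h i * P k h * G k l * P l h' * Q h' j)"
    unfolding congruence_transform_def by (simp add: sum_distrib_left sum_distrib_right mult.assoc)
  also have "\<dots> = (\<Sum>h<m. \<Sum>k<m. \<Sum>h'<m. \<Sum>l<m. Q h i * P k h * G k l * P l h' * Q h' j)"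
    by (intro sum.cong refl sum.swap)
  also have "\<dots> = (\<Sum>k<m. \<Sum>h<m. \<Sum>h'<m. \<Sum>l<m. Q h i * P k h * G k l * P l h' * Q h' j)"
    by (rule sum.swap)
  also have "\<dots> = (\<Sum>k<m. \<Sum>h<m. \<Sum>l<m. \<Sum>h'<m. Q h i * P k h * G k l * P l h' * Q h' j)"
    by (intro sum.cong refl sum.swap)
  also have "\<dots> = (\<Sum>k<m. \<Sum>l<m. \<Sum>h<m. \<Sum>h'<m. Q h i * P k h * G k l * P l h' * Q h' j)"
    by (intro sum.cong refl sum.swap)
  also have "\<dots> = congruence_transform m (\<lambda>k l. \<Sum>h<m. P k h * Q h l) G i j"
    unfolding congruence_transform_def by (simp add: sum_distrib_left sum_distrib_right mult_ac)
  finally show ?thesis .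
qed

lemma congruence_transform_id:
  assumes "i < m" "j < m" "\<And>k l. k < m \<Longrightarrow> l < m \<Longrightarrow> P k l = of_bool (k = l)"
  shows "congruence_transform m P G i j = G i j"
proof -
  have "congruence_transform m P G i j = (\<Sum>k<m. \<Sum>l<m. if l = j then (if k = i then G k l else 0) else 0)"
    unfolding congruence_transform_def using assms by (intro sum.cong) auto
  also have "\<dots> = G i j"
    using assms by simp
  finally show ?thesis .
qed

lemma congruence_transform_sym:
  assumes "\<And>k l. G k l = G l k"
  shows "congruence_transform m P G i j = congruence_transform m P G j i"
  unfolding congruence_transform_def
  by (subst sum.swap) (use assms in \<open>simp add: mult_ac\<close>)

subsection \<open>The blocks of a generalized graph manifold\<close>

text \<open>Column convention as for the gluing matrices:
  \<open>(z'\<^sub>w, f'\<^sub>w) = (z\<^sub>w, f\<^sub>w) P\<^sub>w\<close>, with index 0 for the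
  class \<open>z\<^sub>w\<close>.\<close>

definition basis_change :: "nat \<Rightarrow> ('v, 'w, 'a, 'b, 'c) graph_manifold \<Rightarrow> ('w \<Rightarrow> 'a chain set) \<Rightarrow>
    ('v \<Rightarrow> nat \<Rightarrow> (nat \<Rightarrow> complex) chain set) \<Rightarrow> ('w \<Rightarrow> 'a chain set) \<Rightarrow>
    ('v \<Rightarrow> nat \<Rightarrow> (nat \<Rightarrow> complex) chain set) \<Rightarrow> 'w \<Rightarrow> nat \<Rightarrow> nat \<Rightarrow> int" where
  "basis_change n M z f z' f' w i j =
     Z_coords (torus_homology M w) (n - 1) (torus_tuple n M z f w) (torus_tuple n M z' f' w j) i"

definition fiber_basis_change :: "nat \<Rightarrow> ('v \<Rightarrow> nat \<Rightarrow> (nat \<Rightarrow> complex) chain set) \<Rightarrow>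
    ('v \<Rightarrow> nat \<Rightarrow> (nat \<Rightarrow> complex) chain set) \<Rightarrow> 'v \<Rightarrow> nat \<Rightarrow> nat \<Rightarrow> int" where
  "fiber_basis_change n f f' v i j = Z_coords (fiber_homology n) (n - 2) (f v) (f' v j) i"

locale graph_manifold_context =
  fixes n :: nat and M :: "('v, 'w, 'a, 'b, 'c) graph_manifold"
  assumes n3: "3 \<le> n" and M: "generalized_graph_manifold n M"
begin

lemma n_Suc: "n - 1 = Suc (n - 2)"
  using n3 by simp

lemma owner_verts: "w \<in> tori M \<Longrightarrow> owner M w \<in> verts M"
  using M unfolding generalized_graph_manifold_def by (elim conjE) (rule funcset_mem)

lemma finite_verts: "finite (verts M)"
  using M unfolding generalized_graph_manifold_def by (elim conjE)

lemma block_facts: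
  assumes "v \<in> verts M"
  shows "block_surface (surface M v) \<and>
        homeomorphic_map (block M v) (prod_topology (torus (n - 2)) (surface M v)) (triv M v) \<and>
        finite (bdry_index M v) \<and>
        bij_betw (circle M) (bdry_index M v) (boundary_circles (surface M v)) \<and>
        (\<forall>w\<in>bdry_index M v.
           subtopology (surface M v) (circle M w) homeomorphic_space circle_topology)"
  using M assms unfolding generalized_graph_manifold_def boundary_circles_def
  by (elim conjE) (drule bspec[of "verts M" _ v], assumption, assumption)

lemma glued_facts:
  assumes "w \<in> glued M"
  shows "w \<in> tori M" "opp M w \<in> glued M"
    "homeomorphic_maps (bdry_torus M w) (bdry_torus M (opp M w)) (glue M w) (glue M (opp M w))"
proof -
  show "w \<in> tori M"
    using M assms unfolding generalized_graph_manifold_def by (elim conjE) (rule subsetD)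
  have "opp M w \<in> glued M \<and> opp M w \<noteq> w \<and> opp M (opp M w) = w \<and>
        homeomorphic_maps (bdry_torus M w) (bdry_torus M (opp M w)) (glue M w) (glue M (opp M w)) \<and>
        (\<exists>g. torus_diffeomorphism (n - 1) g \<and>
           (\<forall>t\<in>topspace (torus (n - 1)). glue M w (param M w t) = param M (opp M w) (g t)))"
    using M assms unfolding generalized_graph_manifold_def
    by (elim conjE) (drule bspec[of "glued M" _ w], assumption, assumption)
  then show "opp M w \<in> glued M"
    "homeomorphic_maps (bdry_torus M w) (bdry_torus M (opp M w)) (glue M w) (glue M (opp M w))"
    by simp_all
qed

lemma finite_bdry_index: "v \<in> verts M \<Longrightarrow> finite (bdry_index M v)"
  using block_facts by simp

lemma block_surface: "v \<in> verts M \<Longrightarrow> block_surface (surface M v)"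
  using block_facts by simp

lemma triv_homeomorphic: "v \<in> verts M \<Longrightarrow>
    homeomorphic_map (block M v) (prod_topology (torus (n - 2)) (surface M v)) (triv M v)"
  using block_facts by simp

lemma circle_bij: "v \<in> verts M \<Longrightarrow> bij_betw (circle M) (bdry_index M v) (boundary_circles (surface M v))"
  using block_facts by simp

lemma circle_homeomorphic: "v \<in> verts M \<Longrightarrow> w \<in> bdry_index M v \<Longrightarrow>
    subtopology (surface M v) (circle M w) homeomorphic_space circle_topology"
  using block_facts by simp

lemma finite_tori: "finite (tori M)"
proof -
  have "tori M \<subseteq> (\<Union>v\<in>verts M. bdry_index M v)"
    using owner_verts by (auto simp: bdry_index_def)
  moreover have "finite (\<Union>v\<in>verts M. bdry_index M v)"
    using finite_verts finite_bdry_index by simp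
  ultimately show ?thesis
    by (rule finite_subset)
qed

lemma glued_tori: "w \<in> glued M \<Longrightarrow> w \<in> tori M" "w \<in> glued M \<Longrightarrow> opp M w \<in> tori M"
  using glued_facts by simp_all

lemma glue_homeomorphic:
  assumes "w \<in> glued M"
  shows "homeomorphic_map (bdry_torus M w) (bdry_torus M (opp M w)) (glue M w)"
proof -
  have "homeomorphic_maps (bdry_torus M w) (bdry_torus M (opp M w)) (glue M w) (glue M (opp M w))"
    by (rule glued_facts(3)[OF assms])
  then show ?thesis
    unfolding homeomorphic_maps_map by simp
qed

lemma bdry_index_owner: "w \<in> tori M \<Longrightarrow> w \<in> bdry_index M (owner M w)"
  by (simp add: bdry_index_def)

lemma circle_boundary:
  assumes "w \<in> tori M"
  shows "circle M w \<in> boundary_circles (surface M (owner M w))"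
  using circle_bij[OF owner_verts[OF assms]] bdry_index_owner[OF assms] by (auto simp: bij_betw_def)

lemma circle_subset:
  assumes "w \<in> tori M"
  shows "circle M w \<subseteq> manifold_boundary 2 (surface M (owner M w))"
  by (rule boundary_circles_subset[OF circle_boundary[OF assms]])

lemma continuous_projections:
  assumes "v \<in> verts M"
  shows "continuous_map (block M v) (torus (n - 2)) (\<lambda>x. fst (triv M v x))"
    "continuous_map (block M v) (surface M v) (\<lambda>x. snd (triv M v x))"
  using homeomorphic_imp_continuous_map[OF triv_homeomorphic[OF assms]]
  by (auto simp: continuous_map_pairwise comp_def)

lemma topspace_bdry_torus:
  "topspace (bdry_torus M w) = {x \<in> topspace (block M (owner M w)). snd (triv M (owner M w) x) \<in> circle M w}"
  by (auto simp: bdry_torus_def)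

lemma continuous_from_bdry_torus:
  assumes "continuous_map (block M (owner M w)) Y g"
  shows "continuous_map (bdry_torus M w) Y g"
  using assms by (simp add: bdry_torus_def continuous_map_from_subtopology)

text \<open>Replaces the definition by \<open>inv_into\<close> and \<open>SOME\<close> with what is
  used later: in the trivialization the fiber lies over a single point \<open>c\<close>.\<close>

lemma fiber_incl:
  assumes "w \<in> tori M"
  obtains c where "c \<in> circle M w" "continuous_map (torus (n - 2)) (bdry_torus M w) (fiber_incl M w)"
    "\<And>\<tau>. \<tau> \<in> topspace (torus (n - 2)) \<Longrightarrow> triv M (owner M w) (fiber_incl M w \<tau>) = (\<tau>, c)"
proof -
  let ?v = "owner M w"
  let ?F = "torus (n - 2)" and ?S = "surface M ?v"
  define c where "c = (SOME c. c \<in> circle M w)"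
  have "circle M w \<noteq> {}"
    using circle_boundary[OF assms] nonempty_connected_components_of unfolding boundary_circles_def by blast
  then have c: "c \<in> circle M w"
    by (simp add: c_def some_in_eq)
  then have cS: "c \<in> topspace ?S"
    using circle_subset[OF assms] manifold_boundary_subset by (meson subsetD)
  have h: "homeomorphic_map (block M ?v) (prod_topology ?F ?S) (triv M ?v)"
    by (rule triv_homeomorphic[OF owner_verts[OF assms]])
  then obtain t' where t': "homeomorphic_maps (block M ?v) (prod_topology ?F ?S) (triv M ?v) t'"
    unfolding homeomorphic_map_maps by blast
  have inv: "inv_into (topspace (block M ?v)) (triv M ?v) y = t' y" if "y \<in> topspace (prod_topology ?F ?S)" for y
  proof (rule inv_into_f_eq)
    show "inj_on (triv M ?v) (topspace (block M ?v))"
      by (rule homeomorphic_imp_injective_map[OF h])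
    show "t' y \<in> topspace (block M ?v)" "triv M ?v (t' y) = y"
      using t' that unfolding homeomorphic_maps_def by (auto simp: continuous_map_def)
  qed
  have f: "fiber_incl M w \<tau> = t' (\<tau>, c)" if "\<tau> \<in> topspace ?F" for \<tau>
    using inv[of "(\<tau>, c)"] that cS by (simp add: fiber_incl_def c_def)
  have tr: "triv M ?v (fiber_incl M w \<tau>) = (\<tau>, c)" if "\<tau> \<in> topspace ?F" for \<tau>
    using t' f[OF that] that cS unfolding homeomorphic_maps_def by auto
  have "continuous_map ?F (prod_topology ?F ?S) (\<lambda>\<tau>. (\<tau>, c))"
    using cS by (simp add: continuous_map_pairwise comp_def)
  then have "continuous_map ?F (block M ?v) (t' \<circ> (\<lambda>\<tau>. (\<tau>, c)))"
    using t' unfolding homeomorphic_maps_def by (metis continuous_map_compose)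
  then have "continuous_map ?F (block M ?v) (fiber_incl M w)"
    by (rule continuous_map_eq) (simp add: f)
  then have "continuous_map ?F (bdry_torus M w) (fiber_incl M w)"
    unfolding bdry_torus_def using tr c by (auto simp: continuous_map_in_subtopology)
  then show thesis
    using that c tr by blast
qed

text \<open>A loop in the boundary circle is lifted to the torus with constant fiber coordinate.
  This provides a class on which the projection to the circle can be evaluated.\<close>

lemma circle_section:
  assumes "w \<in> tori M" "continuous_map circle_topology (subtopology (surface M (owner M w)) (circle M w)) \<kappa>"
  obtains \<sigma> where "continuous_map circle_topology (bdry_torus M w) \<sigma>"
    "\<And>x. x \<in> topspace circle_topology \<Longrightarrow> snd (triv M (owner M w) (\<sigma> x)) = \<kappa> x"
proof -
  let ?v = "owner M w"
  let ?F = "torus (n - 2)" and ?S = "surface M ?v"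
  obtain t' where t': "homeomorphic_maps (block M ?v) (prod_topology ?F ?S) (triv M ?v) t'"
    using triv_homeomorphic[OF owner_verts[OF assms(1)]] unfolding homeomorphic_map_maps by blast
  \<comment> \<open>Any point of the fiber torus would do.\<close>
  define \<tau> where "\<tau> = (\<lambda>i\<in>{..<n - 2}. 1 :: complex)"
  have \<tau>: "\<tau> \<in> topspace ?F"
    by (auto simp: \<tau>_def torus_def circle_topology_def)
  have \<kappa>: "continuous_map circle_topology ?S \<kappa>" "\<kappa> x \<in> circle M w" if "x \<in> topspace circle_topology" for x
    using assms(2) that by (auto simp: continuous_map_in_subtopology)
  have \<kappa>c: "continuous_map circle_topology ?S \<kappa>"
    using assms(2) by (simp add: continuous_map_in_subtopology)
  have "continuous_map circle_topology (prod_topology ?F ?S) (\<lambda>x. (\<tau>, \<kappa> x))"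
    using \<tau> \<kappa>c by (simp add: continuous_map_pairwise comp_def)
  then have c: "continuous_map circle_topology (block M ?v) (t' \<circ> (\<lambda>x. (\<tau>, \<kappa> x)))"
    using t' unfolding homeomorphic_maps_def by (metis continuous_map_compose)
  have s: "triv M ?v (t' (\<tau>, \<kappa> x)) = (\<tau>, \<kappa> x)" if "x \<in> topspace circle_topology" for x
  proof -
    have "\<kappa> x \<in> topspace ?S"
      using \<kappa>c that by (auto simp: continuous_map_def)
    then show ?thesis
      using t' \<tau> unfolding homeomorphic_maps_def by simp
  qed
  show thesis
  proof
    show "continuous_map circle_topology (bdry_torus M w) (t' \<circ> (\<lambda>x. (\<tau>, \<kappa> x)))"
      unfolding bdry_torus_def using c s \<kappa>(2) by (auto simp: continuous_map_in_subtopology)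
  qed (simp add: s)
qed

end

locale Waldhausen_context = graph_manifold_context n M
  for n :: nat and M :: "('v, 'w, 'a, 'b, 'c) graph_manifold" +
  fixes z :: "'w \<Rightarrow> 'a chain set" and f :: "'v \<Rightarrow> nat \<Rightarrow> (nat \<Rightarrow> complex) chain set"
  assumes W: "Waldhausen_basis n M z f"
begin

lemma fiber_basis: "v \<in> verts M \<Longrightarrow> is_Z_basis (fiber_homology n) (n - 2) (f v)"
  using W by (simp add: Waldhausen_basis_def)

lemma torus_basis: "w \<in> tori M \<Longrightarrow> is_Z_basis (torus_homology M w) (n - 1) (torus_tuple n M z f w)"
  using W owner_verts bdry_index_owner unfolding Waldhausen_basis_def by blast

lemma torus_tuple_carrier:
  "w \<in> tori M \<Longrightarrow> torus_tuple n M z f w \<in> {..<n - 1} \<rightarrow> carrier (torus_homology M w)"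
  using torus_basis by (simp add: is_Z_basis_def)

lemma torus_tuple_simps:
  "torus_tuple n M z f w 0 = z w" "torus_tuple n M z f w (Suc k) = fiber_hom n M w (f (owner M w) k)"
  by (simp_all add: torus_tuple_def)

text \<open>The boundary relation is applied after mapping the whole block to a simpler space: to
  the circle for the signs, to the fiber torus for the first columns.\<close>

lemma boundary_sum:
  assumes v: "v \<in> verts M" and g: "continuous_map (block M v) Y g"
  shows "finprod (H1 Y) (\<lambda>w. H1_map (bdry_torus M w) Y g (z w)) (bdry_index M v) = \<one>\<^bsub>H1 Y\<^esub>"
proof -
  let ?i = "\<lambda>w. H1_map (bdry_torus M w) (block M v) id (z w)"
  have "finprod (H1 (block M v)) ?i (bdry_index M v) = \<one>\<^bsub>H1 (block M v)\<^esub>"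
    using W v unfolding Waldhausen_basis_def represents_boundary_def by blast
  then have "H1_map (block M v) Y g (finprod (H1 (block M v)) ?i (bdry_index M v)) = \<one>\<^bsub>H1 Y\<^esub>"
    using hom_one[OF hom_induced_empty_hom group_H1(1) group_H1(1)] by metis
  also have "H1_map (block M v) Y g (finprod (H1 (block M v)) ?i (bdry_index M v))
      = finprod (H1 Y) (\<lambda>w. H1_map (block M v) Y g (?i w)) (bdry_index M v)"
    by (rule hom_finprod[OF abelian_homology_group abelian_homology_group hom_induced_empty_hom finite_bdry_index[OF v]])
       simp
  also have "\<dots> = finprod (H1 Y) (\<lambda>w. H1_map (bdry_torus M w) Y g (z w)) (bdry_index M v)"
  proof (rule comm_monoid.finprod_cong'[OF group_H1(2)])
    show "H1_map (block M v) Y g (?i w) = H1_map (bdry_torus M w) Y g (z w)" if "w \<in> bdry_index M v" for w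
      using that by (intro H1_map_compose[OF _ g])
        (auto simp: bdry_torus_def bdry_index_def intro: continuous_map_from_subtopology)
  qed auto
  finally show ?thesis .
qed

lemma H1_map_torus_combination:
  assumes w: "w \<in> tori M"
  shows "H1_map (bdry_torus M w) Y g (Z_combination (torus_homology M w) (n - 1) (torus_tuple n M z f w) c)
    = H1_map (bdry_torus M w) Y g (z w) [^]\<^bsub>H1 Y\<^esub> c 0 \<otimes>\<^bsub>H1 Y\<^esub>
      Z_combination (H1 Y) (n - 2) (\<lambda>i. H1_map (bdry_torus M w) Y g (fiber_hom n M w (f (owner M w) i))) (\<lambda>i. c (Suc i))"
proof -
  have "H1_map (bdry_torus M w) Y g (Z_combination (torus_homology M w) (n - 1) (torus_tuple n M z f w) c)
     = Z_combination (H1 Y) (n - 1) (\<lambda>i. H1_map (bdry_torus M w) Y g (torus_tuple n M z f w i)) c"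
    using torus_tuple_carrier[OF w] unfolding torus_homology_def
    by (intro hom_Z_combination[OF abelian_homology_group abelian_homology_group hom_induced_empty_hom])
  then show ?thesis
    unfolding n_Suc by (subst (asm) comm_group.Z_combination_Suc[OF abelian_homology_group])
      (simp_all add: torus_tuple_simps)
qed

text \<open>The fiber inclusion is a section of the projection to the fiber torus.\<close>

lemma fiber_retract:
  assumes w: "w \<in> tori M" and a: "a \<in> carrier (fiber_homology n)"
  shows "H1_map (bdry_torus M w) (torus (n - 2)) (\<lambda>x. fst (triv M (owner M w) x)) (fiber_hom n M w a) = a"
proof -
  obtain c where c: "continuous_map (torus (n - 2)) (bdry_torus M w) (fiber_incl M w)"
    "\<And>\<tau>. \<tau> \<in> topspace (torus (n - 2)) \<Longrightarrow> triv M (owner M w) (fiber_incl M w \<tau>) = (\<tau>, c)"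
    by (rule fiber_incl[OF w]) (rule that)
  have "H1_map (bdry_torus M w) (torus (n - 2)) (\<lambda>x. fst (triv M (owner M w) x)) (fiber_hom n M w a)
    = H1_map (torus (n - 2)) (torus (n - 2)) (\<lambda>x. x) a"
    unfolding fiber_hom_def
    by (rule H1_map_compose[OF c(1) continuous_from_bdry_torus[OF continuous_projections(1)[OF owner_verts[OF w]]]])
       (simp add: c(2))
  then show ?thesis
    using H1_map_id[of a] a by (simp add: fiber_homology_def)
qed

text \<open>The surface coordinate is constant along a fiber, so a map that factors through the
  surface kills the fiber classes and detects only the multiple of \<open>z w\<close>.\<close>

lemma fiber_surface_trivial:
  assumes w: "w \<in> tori M" and g: "continuous_map (surface M (owner M w)) Y g"
  shows "H1_map (bdry_torus M w) Y (\<lambda>x. g (snd (triv M (owner M w) x))) (fiber_hom n M w a) = \<one>\<^bsub>H1 Y\<^esub>"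
proof -
  obtain c where c: "c \<in> circle M w" "continuous_map (torus (n - 2)) (bdry_torus M w) (fiber_incl M w)"
    "\<And>\<tau>. \<tau> \<in> topspace (torus (n - 2)) \<Longrightarrow> triv M (owner M w) (fiber_incl M w \<tau>) = (\<tau>, c)"
    by (rule fiber_incl[OF w]) (rule that)
  have "c \<in> topspace (surface M (owner M w))"
    using c(1) circle_subset[OF w] manifold_boundary_subset by (meson subsetD)
  then have gc: "g c \<in> topspace Y"
    using g by (auto simp: continuous_map_def)
  have "continuous_map (block M (owner M w)) Y (\<lambda>x. g (snd (triv M (owner M w) x)))"
    using continuous_map_compose[OF continuous_projections(2)[OF owner_verts[OF w]] g] by (simp add: comp_def)
  then have "H1_map (bdry_torus M w) Y (\<lambda>x. g (snd (triv M (owner M w) x))) (fiber_hom n M w a)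
    = H1_map (torus (n - 2)) Y (\<lambda>_. g c) a"
    unfolding fiber_hom_def
    by (intro H1_map_compose[OF c(2) continuous_from_bdry_torus]) (simp_all add: c(3))
  then show ?thesis
    using gc by (simp add: H1_map_const)
qed

end

subsection \<open>Change of the Waldhausen basis\<close>

text \<open>An interpretation with the two bases exchanged supplies the statements about the inverse
  matrices \<open>Q\<close> and the reverse inequality of ranks.\<close>

locale Waldhausen_pair = old: Waldhausen_context n M z f + new: Waldhausen_context n M z' f'
  for n :: nat and M :: "('v, 'w, 'a, 'b, 'c) graph_manifold" and z f z' f'
begin

abbreviation P :: "'w \<Rightarrow> nat \<Rightarrow> nat \<Rightarrow> int" where
  "P \<equiv> basis_change n M z f z' f'"

abbreviation Q :: "'w \<Rightarrow> nat \<Rightarrow> nat \<Rightarrow> int" where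
  "Q \<equiv> basis_change n M z' f' z f"

abbreviation A :: "'v \<Rightarrow> nat \<Rightarrow> nat \<Rightarrow> int" where
  "A \<equiv> fiber_basis_change n f f'"

lemma comm_group_torus_homology: "comm_group (torus_homology M w)"
  unfolding torus_homology_def by (rule abelian_homology_group)

lemma new_torus_tuple:
  assumes "w \<in> tori M" "j < n - 1"
  shows "torus_tuple n M z' f' w j
    = Z_combination (torus_homology M w) (n - 1) (torus_tuple n M z f w) (\<lambda>i. P w i j)"
  using Z_combination_Z_coords[OF old.torus_basis[OF assms(1)], of "torus_tuple n M z' f' w j"]
    new.torus_tuple_carrier[OF assms(1)] assms(2)
  by (auto simp: basis_change_def[abs_def])

lemma new_fiber_basis:
  assumes "v \<in> verts M" "j < n - 2"
  shows "f' v j = Z_combination (fiber_homology n) (n - 2) (f v) (\<lambda>i. A v i j)"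
  using Z_combination_Z_coords[OF old.fiber_basis[OF assms(1)], of "f' v j"]
    new.fiber_basis[OF assms(1)] assms(2)
  by (auto simp: fiber_basis_change_def[abs_def] is_Z_basis_def)

text \<open>The two fiber bases are related already in the homology of the fiber torus. Applying
  \<open>fiber_hom\<close> transports this relation to \<open>T\<^sub>w\<close> with the same
  coefficients and without a multiple of \<open>z w\<close>.\<close>

lemma basis_change_fiber_columns:
  assumes w: "w \<in> tori M" and j: "j < n - 2"
  shows "P w 0 (Suc j) = 0" "i < n - 2 \<Longrightarrow> P w (Suc i) (Suc j) = A (owner M w) i j"
proof -
  let ?v = "owner M w" and ?L = "torus_homology M w"
  have v: "?v \<in> verts M"
    by (rule old.owner_verts[OF w])
  let ?c = "case_nat 0 (\<lambda>i. A ?v i j)"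
  have t: "torus_tuple n M z f w \<in> {..<Suc (n - 2)} \<rightarrow> carrier ?L"
    using old.torus_tuple_carrier[OF w] unfolding old.n_Suc .
  have "torus_tuple n M z' f' w (Suc j) = fiber_hom n M w (Z_combination (fiber_homology n) (n - 2) (f ?v) (\<lambda>i. A ?v i j))"
    using new_fiber_basis[OF v j] by (simp add: new.torus_tuple_simps)
  also have "\<dots> = Z_combination ?L (n - 2) (\<lambda>i. fiber_hom n M w (f ?v i)) (\<lambda>i. A ?v i j)"
    unfolding fiber_hom_def torus_homology_def
    using old.fiber_basis[OF v] unfolding fiber_homology_def
    by (intro hom_Z_combination abelian_homology_group hom_induced_empty_hom) (simp add: is_Z_basis_def)
  also have "\<dots> = Z_combination ?L (Suc (n - 2)) (torus_tuple n M z f w) ?c"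
    using comm_group.Z_combination_Suc[OF comm_group_torus_homology t, of ?c]
      comm_group.Z_combination_closed[OF comm_group_torus_homology, of "\<lambda>i. fiber_hom n M w (f ?v i)" "n - 2" w]
      t group.is_monoid[OF comm_group.axioms(2)[OF comm_group_torus_homology]]
    by (simp add: old.torus_tuple_simps fiber_hom_def torus_homology_def
        comm_group.Z_combination_closed[OF abelian_homology_group])
  finally have eq: "torus_tuple n M z' f' w (Suc j) = Z_combination ?L (n - 1) (torus_tuple n M z f w) ?c"
    unfolding old.n_Suc .
  have P: "P w i (Suc j) = ?c i" if "i < n - 1" for i
    unfolding basis_change_def
    by (rule comm_group.Z_coords_eq[OF comm_group_torus_homology old.torus_basis[OF w] eq that])
  show "P w 0 (Suc j) = 0"
    using P[of 0] old.n3 by simp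
  show "P w (Suc i) (Suc j) = A (owner M w) i j" if "i < n - 2"
    using P[of "Suc i"] that by simp
qed

lemma basis_change_inverse:
  assumes w: "w \<in> tori M" and ij: "i < n - 1" "j < n - 1"
  shows "(\<Sum>k<n - 1. P w i k * Q w k j) = of_bool (i = j)"
proof -
  let ?L = "torus_homology M w" and ?t = "torus_tuple n M z f w" and ?t' = "torus_tuple n M z' f' w"
  interpret rev: Waldhausen_pair n M z' f' z f
    by unfold_locales
  interpret L: comm_group ?L
    by (rule comm_group_torus_homology)
  have "?t j = Z_combination ?L (n - 1) ?t' (\<lambda>k. Q w k j)"
    by (rule rev.new_torus_tuple[OF w ij(2)])
  also have "\<dots> = Z_combination ?L (n - 1) (\<lambda>k. Z_combination ?L (n - 1) ?t (\<lambda>i. P w i k)) (\<lambda>k. Q w k j)"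
    using new.torus_tuple_carrier[OF w] new_torus_tuple[OF w] by (intro L.Z_combination_cong) auto
  also have "\<dots> = Z_combination ?L (n - 1) ?t (\<lambda>i. \<Sum>k<n - 1. P w i k * Q w k j)"
    by (rule L.Z_combination_Z_combination[OF old.torus_tuple_carrier[OF w]])
  finally have "Z_combination ?L (n - 1) ?t (\<lambda>i. of_bool (i = j))
      = Z_combination ?L (n - 1) ?t (\<lambda>i. \<Sum>k<n - 1. P w i k * Q w k j)"
    using L.Z_combination_unit[OF old.torus_tuple_carrier[OF w] ij(2)] by simp
  from L.Z_basis_coeffs_unique[OF old.torus_basis[OF w] this ij(1)] show ?thesis
    by simp
qed

text \<open>By the zeros in row 0, the corner of the identity matrix \<open>P Q\<close> is the
  product of the two corners, so both are units of the integers.\<close>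

lemma basis_change_corner:
  assumes w: "w \<in> tori M"
  shows "P w 0 0 = 1 \<or> P w 0 0 = -1"
proof -
  have "(\<Sum>k<n - 1. P w 0 k * Q w k 0) = 1"
    using basis_change_inverse[OF w, of 0 0] old.n3 by simp
  also have "(\<Sum>k<n - 1. P w 0 k * Q w k 0) = P w 0 0 * Q w 0 0 + (\<Sum>k<n - 2. P w 0 (Suc k) * Q w (Suc k) 0)"
    unfolding old.n_Suc by (rule sum.lessThan_Suc_shift)
  also have "(\<Sum>k<n - 2. P w 0 (Suc k) * Q w (Suc k) 0) = 0"
    using basis_change_fiber_columns(1)[OF w] by (intro sum.neutral) simp
  finally show ?thesis
    by (auto simp: zmult_eq_1_iff)
qed

lemma new_boundary_class:
  assumes w: "w \<in> tori M"
  shows "H1_map (bdry_torus M w) Y g (z' w) = H1_map (bdry_torus M w) Y g (z w) [^]\<^bsub>H1 Y\<^esub> P w 0 0 \<otimes>\<^bsub>H1 Y\<^esub>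
      Z_combination (H1 Y) (n - 2) (\<lambda>i. H1_map (bdry_torus M w) Y g (fiber_hom n M w (f (owner M w) i))) (\<lambda>i. P w (Suc i) 0)"
  using old.H1_map_torus_combination[OF w, of Y g "\<lambda>i. P w i 0"] new_torus_tuple[OF w, of 0] old.n3
  by (simp add: new.torus_tuple_simps)

text \<open>The identity
  \<open>P\<^sub>w \<Psi>'\<^sub>w = \<Psi>\<^sub>w P\<^sub>-\<^sub>w\<close>. Both sides are
  coordinates of the new tuple on the opposite torus with respect to the transported old basis,
  computed through the new basis of \<open>T\<^sub>w\<close> or through the old basis of the
  opposite torus.\<close>

lemma gluing_matrix_change:
  assumes w: "w \<in> glued M" and ij: "i < n - 1" "j < n - 1"
  shows "(\<Sum>k<n - 1. P w i k * gluing_matrix n M z' f' w k j)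
    = (\<Sum>k<n - 1. gluing_matrix n M z f w i k * P (opp M w) k j)"
proof -
  let ?m = "n - 1" and ?w = "opp M w"
  let ?L = "torus_homology M ?w"
  let ?\<psi> = "hom_induced 1 (bdry_torus M w) {} (bdry_torus M ?w) {} (glue M w)"
  let ?t = "torus_tuple n M z f" and ?t' = "torus_tuple n M z' f'"
  have wt: "w \<in> tori M" "?w \<in> tori M"
    using old.glued_tori[OF w] by simp_all
  have iso: "?\<psi> \<in> iso (torus_homology M w) ?L"
    unfolding torus_homology_def by (rule homeomorphic_map_homology_iso[OF old.glue_homeomorphic[OF w]])
  then have hom: "?\<psi> \<in> hom (torus_homology M w) ?L"
    by (simp add: iso_def)
  interpret L: comm_group ?L
    by (rule comm_group_torus_homology)
  have B: "is_Z_basis ?L ?m (\<lambda>k. ?\<psi> (?t w k))"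
    by (rule is_Z_basis_iso[OF comm_group_torus_homology comm_group_torus_homology iso old.torus_basis[OF wt(1)]])
  have B': "is_Z_basis ?L ?m (\<lambda>k. ?\<psi> (?t' w k))"
    by (rule is_Z_basis_iso[OF comm_group_torus_homology comm_group_torus_homology iso new.torus_basis[OF wt(1)]])
  have c: "(\<lambda>k. ?\<psi> (?t w k)) \<in> {..<?m} \<rightarrow> carrier ?L"
    using B by (simp add: is_Z_basis_def)
  have \<Psi>: "?t ?w k = Z_combination ?L ?m (\<lambda>k. ?\<psi> (?t w k)) (\<lambda>i. gluing_matrix n M z f w i k)" if "k < ?m" for k
    using Z_combination_Z_coords[OF B, of "?t ?w k"] old.torus_tuple_carrier[OF wt(2)] that
    by (auto simp: gluing_matrix_def[abs_def] Z_coords_def[abs_def])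
  have \<Psi>': "?t' ?w j = Z_combination ?L ?m (\<lambda>k. ?\<psi> (?t' w k)) (\<lambda>i. gluing_matrix n M z' f' w i j)"
    using Z_combination_Z_coords[OF B', of "?t' ?w j"] new.torus_tuple_carrier[OF wt(2)] ij(2)
    by (auto simp: gluing_matrix_def[abs_def] Z_coords_def[abs_def])
  have \<psi>: "?\<psi> (?t' w k) = Z_combination ?L ?m (\<lambda>k. ?\<psi> (?t w k)) (\<lambda>i. P w i k)" if "k < ?m" for k
    using hom_Z_combination[OF comm_group_torus_homology comm_group_torus_homology hom old.torus_tuple_carrier[OF wt(1)]]
      new_torus_tuple[OF wt(1) that] by simp
  have "Z_combination ?L ?m (\<lambda>k. ?\<psi> (?t w k)) (\<lambda>i. \<Sum>k<?m. P w i k * gluing_matrix n M z' f' w k j)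
      = Z_combination ?L ?m (\<lambda>k. Z_combination ?L ?m (\<lambda>k. ?\<psi> (?t w k)) (\<lambda>i. P w i k)) (\<lambda>k. gluing_matrix n M z' f' w k j)"
    by (rule L.Z_combination_Z_combination[OF c, symmetric])
  also have "\<dots> = ?t' ?w j"
    unfolding \<Psi>' using c by (intro L.Z_combination_cong) (auto simp: \<psi>)
  also have "\<dots> = Z_combination ?L ?m (?t ?w) (\<lambda>k. P ?w k j)"
    by (rule new_torus_tuple[OF wt(2) ij(2)])
  also have "\<dots> = Z_combination ?L ?m (\<lambda>k. Z_combination ?L ?m (\<lambda>k. ?\<psi> (?t w k)) (\<lambda>i. gluing_matrix n M z f w i k)) (\<lambda>k. P ?w k j)"
    using old.torus_tuple_carrier[OF wt(2)] \<Psi> by (intro L.Z_combination_cong) auto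
  also have "\<dots> = Z_combination ?L ?m (\<lambda>k. ?\<psi> (?t w k)) (\<lambda>i. \<Sum>k<?m. gluing_matrix n M z f w i k * P ?w k j)"
    by (rule L.Z_combination_Z_combination[OF c])
  finally show ?thesis
    by (rule L.Z_basis_coeffs_unique[OF B _ ij(1)])
qed

section \<open>Signs and first columns of the change of basis\<close>

lemma boundary_class_surface:
  assumes w: "w \<in> tori M" and g: "continuous_map (surface M (owner M w)) Y g"
  shows "H1_map (bdry_torus M w) Y (\<lambda>x. g (snd (triv M (owner M w) x))) (z' w)
    = H1_map (bdry_torus M w) Y (\<lambda>x. g (snd (triv M (owner M w) x))) (z w) [^]\<^bsub>H1 Y\<^esub> P w 0 0"
proof -
  have "Z_combination (H1 Y) (n - 2) (\<lambda>i. \<one>\<^bsub>H1 Y\<^esub>) c = \<one>\<^bsub>H1 Y\<^esub>" for c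
    unfolding Z_combination_def
    by (intro comm_monoid.finprod_one_eqI[OF group_H1(2)]) (simp add: group.int_pow_one)
  then show ?thesis
    using new_boundary_class[OF w, of Y] old.fiber_surface_trivial[OF w g]
    by (simp add: group.int_pow_closed monoid.r_one[OF group.is_monoid])
qed

text \<open>The fiber classes are killed, so if \<open>z w\<close> were killed too, the induced map
  would vanish on all of the homology of the torus. On the lift of the inverse of
  \<open>\<kappa>\<close>, however, it is the identity of the circle.\<close>

lemma boundary_class_circle_nontrivial:
  assumes w: "w \<in> tori M" and g: "continuous_map (surface M (owner M w)) circle_topology g"
    and \<kappa>: "homeomorphic_map (subtopology (surface M (owner M w)) (circle M w)) circle_topology \<kappa>"
    and g\<kappa>: "\<And>x. x \<in> circle M w \<Longrightarrow> g x = \<kappa> x"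
  shows "H1_map (bdry_torus M w) circle_topology (\<lambda>x. g (snd (triv M (owner M w) x))) (z w) \<noteq> \<one>\<^bsub>H1 circle_topology\<^esub>"
    (is "?\<phi> (z w) \<noteq> _")
proof
  let ?S = "surface M (owner M w)" and ?O = "circle_topology"
  interpret H: comm_group "H1 ?O"
    by (rule abelian_homology_group)
  assume 1: "?\<phi> (z w) = \<one>\<^bsub>H1 ?O\<^esub>"
  have triv: "?\<phi> x = \<one>\<^bsub>H1 ?O\<^esub>" if x: "x \<in> carrier (torus_homology M w)" for x
  proof -
    have "Z_combination (H1 ?O) (n - 2) (\<lambda>i. \<one>\<^bsub>H1 ?O\<^esub>) c = \<one>\<^bsub>H1 ?O\<^esub>" for c
      unfolding Z_combination_def
      by (intro comm_monoid.finprod_one_eqI[OF group_H1(2)]) (simp add: group.int_pow_one)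
    then have "?\<phi> (Z_combination (torus_homology M w) (n - 1) (torus_tuple n M z f w) c) = \<one>\<^bsub>H1 ?O\<^esub>" for c
      using old.H1_map_torus_combination[OF w, of ?O] old.fiber_surface_trivial[OF w g] 1
      by (simp add: H.int_pow_one)
    then show ?thesis
      using Z_combination_Z_coords[OF old.torus_basis[OF w] x] by metis
  qed
  obtain \<kappa>' where \<kappa>': "homeomorphic_maps (subtopology ?S (circle M w)) ?O \<kappa> \<kappa>'"
    using \<kappa> unfolding homeomorphic_map_maps by blast
  then have \<kappa>'c: "continuous_map ?O (subtopology ?S (circle M w)) \<kappa>'"
    and \<kappa>\<kappa>': "\<And>x. x \<in> topspace ?O \<Longrightarrow> \<kappa> (\<kappa>' x) = x"
    by (auto simp: homeomorphic_maps_def)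
  obtain \<sigma> where \<sigma>: "continuous_map ?O (bdry_torus M w) \<sigma>"
    "\<And>x. x \<in> topspace ?O \<Longrightarrow> snd (triv M (owner M w) (\<sigma> x)) = \<kappa>' x"
    by (rule old.circle_section[OF w \<kappa>'c]) (rule that)
  have gc: "continuous_map (bdry_torus M w) ?O (\<lambda>x. g (snd (triv M (owner M w) x)))"
    using continuous_map_compose[OF old.continuous_projections(2)[OF old.owner_verts[OF w]] g]
    by (intro old.continuous_from_bdry_torus) (simp add: comp_def)
  obtain a where a: "a \<in> carrier (H1 ?O)" "a \<noteq> \<one>\<^bsub>H1 ?O\<^esub>"
    by (rule H1_circle_nontrivial)
  have "?\<phi> (H1_map ?O (bdry_torus M w) \<sigma> a) = H1_map ?O ?O (\<lambda>x. x) a"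
  proof (rule H1_map_compose[OF \<sigma>(1) gc])
    fix x assume x: "x \<in> topspace ?O"
    then have "\<kappa>' x \<in> circle M w"
      using \<kappa>'c by (auto simp: continuous_map_def)
    then show "x = g (snd (triv M (owner M w) (\<sigma> x)))"
      using x by (simp add: \<sigma>(2) g\<kappa> \<kappa>\<kappa>')
  qed
  also have "\<dots> = a"
    using a(1) by (intro H1_map_id) simp_all
  finally show False
    using triv[of "H1_map ?O (bdry_torus M w) \<sigma> a"] a(2) by (simp add: torus_homology_def)
qed

lemma basis_change_corner_constant:
  assumes w: "w1 \<in> tori M" "w2 \<in> tori M" "owner M w1 = owner M w2"
  shows "P w1 0 0 = P w2 0 0"
proof (cases "w1 = w2")
  case False
  let ?v = "owner M w1"
  let ?S = "surface M ?v" and ?O = "circle_topology" and ?B = "bdry_index M ?v"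
  let ?T = "\<lambda>w. bdry_torus M w"
  have v: "?v \<in> verts M"
    by (rule old.owner_verts[OF w(1)])
  have wB: "w1 \<in> ?B" "w2 \<in> ?B"
    using w by (simp_all add: bdry_index_def)
  have S: "manifold_with_boundary 2 ?S" "compact_space ?S" "connected_space ?S"
    using old.block_surface[OF v] by (simp_all add: block_surface_def)
  have fin: "finite (boundary_circles ?S)"
    using old.circle_bij[OF v] old.finite_bdry_index[OF v] bij_betw_finite by blast
  have inj: "inj_on (circle M) ?B"
    using old.circle_bij[OF v] by (rule bij_betw_imp_inj_on)
  have C1: "circle M w1 \<in> boundary_circles ?S" and C2: "circle M w2 \<in> boundary_circles ?S"
    using old.circle_boundary[OF w(1)] old.circle_boundary[OF w(2)] w(3) by simp_all
  have ne: "circle M w2 \<noteq> circle M w1"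
    using inj wB False by (metis inj_onD)
  obtain \<kappa> where \<kappa>: "homeomorphic_map (subtopology ?S (circle M w1)) ?O \<kappa>"
    using old.circle_homeomorphic[OF v wB(1)] unfolding homeomorphic_space by blast
  obtain g where g: "continuous_map ?S ?O g" "\<And>x. x \<in> circle M w1 \<Longrightarrow> g x = \<kappa> x"
    "\<And>x. x \<in> manifold_boundary 2 ?S \<Longrightarrow> x \<notin> circle M w1 \<Longrightarrow> x \<notin> circle M w2 \<Longrightarrow> g x = 1"
    by (rule circle_map_separating_boundary_circles[OF S C1 boundary_circle_complement_closed[OF fin C1] C2 ne \<kappa>])
       (rule that)
  let ?g = "\<lambda>x. g (snd (triv M ?v x))"
  let ?\<phi> = "\<lambda>w. H1_map (?T w) ?O ?g"
  have gc: "continuous_map (block M ?v) ?O ?g"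
    using continuous_map_compose[OF old.continuous_projections(2)[OF v] g(1)] by (simp add: comp_def)
  have other: "?\<phi> w x = \<one>\<^bsub>H1 ?O\<^esub>" if wx: "w \<in> ?B" "w \<noteq> w1" "w \<noteq> w2" for w x
  proof (rule H1_map_const)
    show "(1 :: complex) \<in> topspace ?O"
      by (simp add: circle_topology_def)
    fix y assume "y \<in> topspace (?T w)"
    then have y: "snd (triv M ?v y) \<in> circle M w"
      using wx by (simp add: old.topspace_bdry_torus bdry_index_def)
    have "circle M w \<in> boundary_circles ?S"
      using old.circle_bij[OF v] wx(1) by (auto simp: bij_betw_def)
    moreover have "circle M w \<noteq> circle M w1" "circle M w \<noteq> circle M w2"
      using inj wB wx by (metis inj_onD)+
    ultimately have "disjnt (circle M w) (circle M w1)" "disjnt (circle M w) (circle M w2)"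
      using pairwise_disjoint_connected_components_of[of "subtopology ?S (manifold_boundary 2 ?S)"] C1 C2
      unfolding boundary_circles_def by (metis pairwiseD)+
    then show "?g y = 1"
      using y boundary_circles_subset[OF \<open>circle M w \<in> boundary_circles ?S\<close>]
      by (intro g(3)) (auto simp: disjnt_iff)
  qed
  interpret H: comm_group "H1 ?O"
    by (rule abelian_homology_group)
  \<comment> \<open>All tori except \<open>w1\<close> and \<open>w2\<close> are mapped to the point
    1, so only two factors of a boundary relation survive.\<close>
  have two: "finprod (H1 ?O) (\<lambda>w. ?\<phi> w (y w)) ?B = ?\<phi> w1 (y w1) \<otimes>\<^bsub>H1 ?O\<^esub> ?\<phi> w2 (y w2)" for y
  proof -
    have "finprod (H1 ?O) (\<lambda>w. ?\<phi> w (y w)) ?B = finprod (H1 ?O) (\<lambda>w. ?\<phi> w (y w)) {w1, w2}"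
      using old.finite_bdry_index[OF v] wB other
      by (intro H.finprod_mono_neutral_cong_right) auto
    also have "\<dots> = ?\<phi> w1 (y w1) \<otimes>\<^bsub>H1 ?O\<^esub> ?\<phi> w2 (y w2)"
      using False by simp
    finally show ?thesis .
  qed
  let ?x1 = "?\<phi> w1 (z w1)" and ?x2 = "?\<phi> w2 (z w2)"
  have r1: "?x1 \<otimes>\<^bsub>H1 ?O\<^esub> ?x2 = \<one>\<^bsub>H1 ?O\<^esub>"
    using old.boundary_sum[OF v gc] two[of z] by simp
  have r2: "?x1 [^]\<^bsub>H1 ?O\<^esub> P w1 0 0 \<otimes>\<^bsub>H1 ?O\<^esub> ?x2 [^]\<^bsub>H1 ?O\<^esub> P w2 0 0 = \<one>\<^bsub>H1 ?O\<^esub>"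
    using new.boundary_sum[OF v gc] two[of z'] boundary_class_surface[OF w(1) g(1)]
      boundary_class_surface[OF w(2), of ?O g] g(1) w(3) by simp
  have n1: "?x1 \<noteq> \<one>\<^bsub>H1 ?O\<^esub>"
    by (rule boundary_class_circle_nontrivial[OF w(1) g(1) \<kappa> g(2)])
  have c: "?x1 \<in> carrier (H1 ?O)" "?x2 \<in> carrier (H1 ?O)"
    by simp_all
  have x2: "?x2 = inv\<^bsub>H1 ?O\<^esub> ?x1"
    using r1 c H.inv_equality H.m_comm by metis
  show ?thesis
  proof (rule ccontr)
    assume "P w1 0 0 \<noteq> P w2 0 0"
    \<comment> \<open>The old relation makes \<open>?x2\<close> the inverse of \<open>?x1\<close>;
      with opposite exponents the new relation then says that \<open>?x1\<close> or its inverse has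
      trivial square.\<close>
    then have "P w1 0 0 = 1 \<and> P w2 0 0 = -1 \<or> P w1 0 0 = -1 \<and> P w2 0 0 = 1"
      using basis_change_corner[OF w(1)] basis_change_corner[OF w(2)] by auto
    then have "?x1 \<otimes>\<^bsub>H1 ?O\<^esub> ?x1 = \<one>\<^bsub>H1 ?O\<^esub>"
    proof
      assume "P w1 0 0 = 1 \<and> P w2 0 0 = -1"
      then show ?thesis
        using r2 c x2 by (simp add: H.int_pow_neg)
    next
      assume "P w1 0 0 = -1 \<and> P w2 0 0 = 1"
      then have "inv\<^bsub>H1 ?O\<^esub> ?x1 \<otimes>\<^bsub>H1 ?O\<^esub> inv\<^bsub>H1 ?O\<^esub> ?x1 = \<one>\<^bsub>H1 ?O\<^esub>"
        using r2 c x2 by (simp add: H.int_pow_neg)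
      then have "inv\<^bsub>H1 ?O\<^esub> (?x1 \<otimes>\<^bsub>H1 ?O\<^esub> ?x1) = \<one>\<^bsub>H1 ?O\<^esub>"
        using c by (simp add: H.inv_mult)
      then show ?thesis
        using c by (metis H.inv_inv H.inv_one H.m_closed)
    qed
    then show False
      using H1_circle_no_2_torsion[OF c(1)] n1 by simp
  qed
qed simp

lemma block_sign:
  obtains \<epsilon> where "\<And>w. w \<in> bdry_index M v \<Longrightarrow> P w 0 0 = \<epsilon>"
proof (cases "bdry_index M v = {}")
  case False
  then obtain w0 where "w0 \<in> bdry_index M v"
    by blast
  then have "P w 0 0 = P w0 0 0" if "w \<in> bdry_index M v" for w
    using that by (intro basis_change_corner_constant) (simp_all add: bdry_index_def)
  then show thesis
    using that by blast
qed auto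

text \<open>After projection the fiber classes become the basis \<open>f v\<close> itself. The new
  boundary relation splits into a power of the old one and a combination of \<open>f v\<close> whose
  coefficients are the sums in question.\<close>

lemma basis_change_first_column_sum:
  assumes v: "v \<in> verts M" and i: "i < n - 2"
  shows "(\<Sum>w\<in>bdry_index M v. P w (Suc i) 0) = 0"
proof -
  let ?F = "torus (n - 2)" and ?B = "bdry_index M v"
  let ?p = "\<lambda>x. fst (triv M v x)"
  let ?\<phi> = "\<lambda>w. H1_map (bdry_torus M w) ?F ?p"
  have pc: "continuous_map (block M v) ?F ?p"
    by (rule old.continuous_projections(1)[OF v])
  interpret H: comm_group "H1 ?F"
    by (rule abelian_homology_group)
  have fv: "f v \<in> {..<n - 2} \<rightarrow> carrier (H1 ?F)"
    using old.fiber_basis[OF v] by (simp add: is_Z_basis_def fiber_homology_def)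
  have z': "?\<phi> w (z' w) = ?\<phi> w (z w) [^]\<^bsub>H1 ?F\<^esub> P w 0 0 \<otimes>\<^bsub>H1 ?F\<^esub> Z_combination (H1 ?F) (n - 2) (f v) (\<lambda>i. P w (Suc i) 0)"
    if w: "w \<in> ?B" for w
  proof -
    have wt: "w \<in> tori M" "owner M w = v"
      using w by (simp_all add: bdry_index_def)
    have "Z_combination (H1 ?F) (n - 2) (\<lambda>i. ?\<phi> w (fiber_hom n M w (f v i))) (\<lambda>i. P w (Suc i) 0)
        = Z_combination (H1 ?F) (n - 2) (f v) (\<lambda>i. P w (Suc i) 0)"
      using old.fiber_retract[OF wt(1)] fv wt(2)
      by (intro H.Z_combination_cong) (auto simp: fiber_homology_def)
    then show ?thesis
      using new_boundary_class[OF wt(1), of ?F ?p] wt(2) by simp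
  qed
  obtain e where e: "\<And>w. w \<in> ?B \<Longrightarrow> P w 0 0 = e"
    by (rule block_sign) (rule that)
  have pow: "finprod (H1 ?F) (\<lambda>w. y w [^]\<^bsub>H1 ?F\<^esub> e) ?B = finprod (H1 ?F) y ?B [^]\<^bsub>H1 ?F\<^esub> e"
    if "y \<in> ?B \<rightarrow> carrier (H1 ?F)" for y
  proof -
    have "(\<lambda>x. x [^]\<^bsub>H1 ?F\<^esub> e) \<in> hom (H1 ?F) (H1 ?F)"
      by (simp add: hom_def H.int_pow_distrib)
    from hom_finprod[OF abelian_homology_group abelian_homology_group this old.finite_bdry_index[OF v] that]
    show ?thesis
      by simp
  qed
  have "\<one>\<^bsub>H1 ?F\<^esub> = finprod (H1 ?F) (\<lambda>w. ?\<phi> w (z' w)) ?B"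
    using new.boundary_sum[OF v pc] by simp
  also have "\<dots> = finprod (H1 ?F) (\<lambda>w. ?\<phi> w (z w) [^]\<^bsub>H1 ?F\<^esub> e \<otimes>\<^bsub>H1 ?F\<^esub>
      Z_combination (H1 ?F) (n - 2) (f v) (\<lambda>i. P w (Suc i) 0)) ?B"
    using fv by (intro H.finprod_cong') (auto simp: z' e)
  also have "\<dots> = finprod (H1 ?F) (\<lambda>w. ?\<phi> w (z w) [^]\<^bsub>H1 ?F\<^esub> e) ?B \<otimes>\<^bsub>H1 ?F\<^esub>
      finprod (H1 ?F) (\<lambda>w. Z_combination (H1 ?F) (n - 2) (f v) (\<lambda>i. P w (Suc i) 0)) ?B"
    using fv by (intro H.finprod_multf) auto
  \<comment> \<open>The common exponent \<open>e\<close> comes out of the product and leaves the old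
    boundary relation; this is where equality of the signs within the block enters.\<close>
  also have "finprod (H1 ?F) (\<lambda>w. ?\<phi> w (z w) [^]\<^bsub>H1 ?F\<^esub> e) ?B = \<one>\<^bsub>H1 ?F\<^esub>"
    using pow[of "\<lambda>w. ?\<phi> w (z w)"] old.boundary_sum[OF v pc] by (simp add: H.int_pow_one)
  also have "finprod (H1 ?F) (\<lambda>w. Z_combination (H1 ?F) (n - 2) (f v) (\<lambda>i. P w (Suc i) 0)) ?B
      = Z_combination (H1 ?F) (n - 2) (f v) (\<lambda>i. \<Sum>w\<in>?B. P w (Suc i) 0)"
    by (rule H.finprod_Z_combination[OF fv old.finite_bdry_index[OF v]])
  finally have "Z_combination (H1 ?F) (n - 2) (f v) (\<lambda>i. \<Sum>w\<in>?B. P w (Suc i) 0)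
      = Z_combination (H1 ?F) (n - 2) (f v) (\<lambda>i. 0)"
    using fv by (simp add: H.Z_combination_zero)
  then show ?thesis
    using H.Z_basis_coeffs_unique[OF old.fiber_basis[OF v, unfolded fiber_homology_def] _ i] by blast
qed

end

subsection \<open>Invariance of the linear system\<close>

lemma sum_fun_apply: "(\<Sum>i\<in>I. h i) x = (\<Sum>i\<in>I. (h i x :: real))"
  by (induction I rule: infinite_finite_induct) auto

lemma G_matrix_simps:
  "G_matrix M w a 0 0 = a (XVar w)"
  "G_matrix M w a 0 (Suc l) = a (LVar w l)"
  "G_matrix M w a (Suc k) 0 = a (LVar w k)"
  "G_matrix M w a (Suc k) (Suc l) = a (GVar (owner M w) (min k l) (max k l))"
  by (simp_all add: G_matrix_def)

lemma G_matrix_sym: "G_matrix M w a i j = G_matrix M w a j i"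
  by (cases i; cases j) (simp_all add: G_matrix_simps min.commute max.commute)

definition gluing_form :: "nat \<Rightarrow> ('v, 'w, 'a, 'b, 'c) graph_manifold \<Rightarrow> ('w \<Rightarrow> 'a chain set) \<Rightarrow>
    ('v \<Rightarrow> nat \<Rightarrow> (nat \<Rightarrow> complex) chain set) \<Rightarrow> 'w \<Rightarrow> nat \<Rightarrow> nat \<Rightarrow> (('v, 'w) ls_var \<Rightarrow> real) \<Rightarrow> real" where
  "gluing_form n M z f w i j a = G_matrix M (opp M w) a i j -
     congruence_transform (n - 1) (\<lambda>k l. of_int (gluing_matrix n M z f w k l)) (G_matrix M w a) i j"

definition vertex_form :: "('v, 'w, 'a, 'b, 'c) graph_manifold \<Rightarrow> 'v \<Rightarrow> nat \<Rightarrow> (('v, 'w) ls_var \<Rightarrow> real) \<Rightarrow> real" where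
  "vertex_form M v k a = (\<Sum>w\<in>bdry_index M v. a (LVar w k))"

lemma LS1_equations_eq:
  "LS1_equations n M z f = {gluing_form n M z f w i j |w i j. w \<in> glued M \<and> i < n - 1 \<and> j < n - 1} \<union>
     {vertex_form M v k |v k. v \<in> verts M \<and> k < n - 2}"
  unfolding LS1_equations_def gluing_form_def[abs_def] vertex_form_def[abs_def] congruence_transform_def ..

context graph_manifold_context
begin

lemma finite_LS1_equations: "finite (LS1_equations n M z f)"
proof -
  have "finite (glued M)"
    using glued_tori(1) finite_tori by (metis finite_subset subsetI)
  then have "finite ((\<lambda>(w, i, j). gluing_form n M z f w i j) ` (glued M \<times> {..<n - 1} \<times> {..<n - 1}))"
    "finite ((\<lambda>(v, k). vertex_form M v k) ` (verts M \<times> {..<n - 2}))"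
    using finite_verts by simp_all
  from finite_UnI[OF this] show ?thesis
    by (rule rev_finite_subset) (force simp: LS1_equations_eq)
qed

text \<open>The equations see an assignment only through the entries of the matrices
  \<open>G\<^sub>w\<close>, and it is on these entries that the substitution is invertible.\<close>

lemma LS1_equations_local:
  assumes e: "e \<in> LS1_equations n M z f"
    and ab: "\<And>w i j. w \<in> tori M \<Longrightarrow> i < n - 1 \<Longrightarrow> j < n - 1 \<Longrightarrow> G_matrix M w a i j = G_matrix M w b i j"
  shows "e a = e b"
  using e unfolding LS1_equations_eq
proof
  assume "e \<in> {gluing_form n M z f w i j |w i j. w \<in> glued M \<and> i < n - 1 \<and> j < n - 1}"
  then obtain w i j where w: "e = gluing_form n M z f w i j" "w \<in> glued M" "i < n - 1" "j < n - 1"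
    by blast
  have "congruence_transform (n - 1) (\<lambda>k l. of_int (gluing_matrix n M z f w k l)) (G_matrix M w a) i j
      = congruence_transform (n - 1) (\<lambda>k l. of_int (gluing_matrix n M z f w k l)) (G_matrix M w b) i j"
    by (rule congruence_transform_cong) (simp_all only: ab[OF glued_tori(1)[OF w(2)]])
  then show ?thesis
    using w ab[OF glued_tori(2)[OF w(2)]] by (simp only: gluing_form_def)
next
  assume "e \<in> {vertex_form M v k |v k. v \<in> verts M \<and> k < n - 2}"
  then obtain v k where v: "e = vertex_form M v k" "k < n - 2"
    by blast
  have "a (LVar w k) = b (LVar w k)" if "w \<in> bdry_index M v" for w
    using ab[of w 0 "Suc k"] v(2) that by (simp add: bdry_index_def G_matrix_simps)
  then show ?thesis
    by (simp add: v(1) vertex_form_def)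
qed

end

context Waldhausen_pair
begin

text \<open>The matrices \<open>G\<^sub>w\<close> of one block share their lower right part, so its
  transform has to be defined by \<open>A\<close> alone, without choosing a torus;
  \<open>x\<^sub>w\<close> and \<open>l\<^sub>w\<close> are read off from the first row of
  \<open>P\<^sub>w\<^sup>T G\<^sub>w P\<^sub>w\<close>.\<close>

definition change_variables :: "(('v, 'w) ls_var \<Rightarrow> real) \<Rightarrow> ('v, 'w) ls_var \<Rightarrow> real" where
  "change_variables a x = (case x of
     XVar w \<Rightarrow> congruence_transform (n - 1) (\<lambda>k l. of_int (P w k l)) (G_matrix M w a) 0 0
   | LVar w k \<Rightarrow> congruence_transform (n - 1) (\<lambda>k l. of_int (P w k l)) (G_matrix M w a) 0 (Suc k)
   | GVar v i j \<Rightarrow> congruence_transform (n - 2) (\<lambda>k l. of_int (A v k l)) (\<lambda>k l. a (GVar v (min k l) (max k l))) i j)"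

text \<open>Consistency of the substitution: by block triangularity the lower right part of the
  transformed matrix is \<open>A\<^sub>v\<^sup>T G\<^sub>v A\<^sub>v\<close>, the same for all tori
  of the block.\<close>

lemma G_matrix_change_variables:
  assumes w: "w \<in> tori M" and ij: "i < n - 1" "j < n - 1"
  shows "G_matrix M w (change_variables a) i j
    = congruence_transform (n - 1) (\<lambda>k l. of_int (P w k l)) (G_matrix M w a) i j"
proof (cases i)
  case 0
  then show ?thesis
    by (cases j) (simp_all add: G_matrix_simps change_variables_def)
next
  case (Suc k)
  show ?thesis
  proof (cases j)
    case 0
    have "congruence_transform (n - 1) (\<lambda>k l. of_int (P w k l)) (G_matrix M w a) i j
        = congruence_transform (n - 1) (\<lambda>k l. of_int (P w k l)) (G_matrix M w a) j i"
      by (rule congruence_transform_sym[OF G_matrix_sym])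
    then show ?thesis
      using Suc 0 by (simp add: G_matrix_simps change_variables_def)
  next
    case (Suc l)
    let ?v = "owner M w"
    let ?g = "\<lambda>k l. a (GVar ?v (min k l) (max k l))"
    have kl: "k < n - 2" "l < n - 2"
      using ij \<open>i = Suc k\<close> Suc by simp_all
    have "congruence_transform (n - 1) (\<lambda>k l. of_int (P w k l)) (G_matrix M w a) i j
        = congruence_transform (n - 2) (\<lambda>k l. of_int (A ?v k l)) ?g k l"
      unfolding congruence_transform_def old.n_Suc \<open>i = Suc k\<close> Suc sum.lessThan_Suc_shift
      using basis_change_fiber_columns[OF w kl(1)] basis_change_fiber_columns[OF w kl(2)]
      by (simp add: G_matrix_simps)
    \<comment> \<open>\<open>G_matrix\<close> reads the variable at ordered indices; symmetry of
      \<open>?g\<close> permits the reordering.\<close>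
    also have "\<dots> = congruence_transform (n - 2) (\<lambda>k l. of_int (A ?v k l)) ?g (min k l) (max k l)"
      using congruence_transform_sym[of ?g "n - 2" _ k l]
      by (cases "k \<le> l") (simp_all add: min.commute max.commute min_def max_def)
    finally show ?thesis
      using \<open>i = Suc k\<close> Suc by (simp add: G_matrix_simps change_variables_def)
  qed
qed

text \<open>By \<open>gluing_matrix_change\<close> the new defect is
  \<open>P\<^sub>-\<^sub>w\<^sup>T (G\<^sub>-\<^sub>w - \<Psi>\<^sub>w\<^sup>T G\<^sub>w
  \<Psi>\<^sub>w) P\<^sub>-\<^sub>w\<close>, whose entries are combinations of the old
  defects.\<close>

lemma gluing_form_change_variables:
  assumes w: "w \<in> glued M" and ij: "i < n - 1" "j < n - 1"
  shows "gluing_form n M z' f' w i j (change_variables a)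
    = (\<Sum>k<n - 1. \<Sum>l<n - 1. of_int (P (opp M w) k i * P (opp M w) l j) * gluing_form n M z f w k l a)"
proof -
  let ?m = "n - 1"
  let ?P = "\<lambda>w k l. real_of_int (P w k l)"
  let ?\<Psi> = "\<lambda>k l. real_of_int (gluing_matrix n M z f w k l)" and ?\<Psi>' = "\<lambda>k l. real_of_int (gluing_matrix n M z' f' w k l)"
  let ?G = "\<lambda>w. G_matrix M w a"
  note t = old.glued_tori[OF w]
  have "congruence_transform ?m ?\<Psi>' (G_matrix M w (change_variables a)) i j
      = congruence_transform ?m ?\<Psi>' (congruence_transform ?m (?P w) (?G w)) i j"
    by (rule congruence_transform_cong) (simp_all add: G_matrix_change_variables[OF t(1)])
  also have "\<dots> = congruence_transform ?m (\<lambda>k l. \<Sum>h<?m. ?P w k h * ?\<Psi>' h l) (?G w) i j"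
    by (rule congruence_transform_transform)
  also have "\<dots> = congruence_transform ?m (\<lambda>k l. \<Sum>h<?m. ?\<Psi> k h * ?P (opp M w) h l) (?G w) i j"
  proof -
    have "(\<Sum>h<?m. ?P w k h * ?\<Psi>' h l) = (\<Sum>h<?m. ?\<Psi> k h * ?P (opp M w) h l)" if "k < ?m" "l < ?m" for k l
      using arg_cong[OF gluing_matrix_change[OF w that], of real_of_int] by simp
    then show ?thesis
      using ij by (intro congruence_transform_cong) simp_all
  qed
  also have "\<dots> = congruence_transform ?m (?P (opp M w)) (congruence_transform ?m ?\<Psi> (?G w)) i j"
    by (rule congruence_transform_transform[symmetric])
  finally have "gluing_form n M z' f' w i j (change_variables a)
      = congruence_transform ?m (?P (opp M w)) (?G (opp M w)) i j
        - congruence_transform ?m (?P (opp M w)) (congruence_transform ?m ?\<Psi> (?G w)) i j"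
    using G_matrix_change_variables[OF t(2) ij] by (simp add: gluing_form_def)
  also have "\<dots> = (\<Sum>k<?m. \<Sum>l<?m. ?P (opp M w) k i * (?G (opp M w) k l - congruence_transform ?m ?\<Psi> (?G w) k l) * ?P (opp M w) l j)"
    unfolding congruence_transform_def[of _ "?P (opp M w)"] by (simp add: sum_subtractf algebra_simps)
  finally show ?thesis
    by (simp add: gluing_form_def mult_ac)
qed

text \<open>With first column \<open>(\<epsilon>, b\<^sub>w)\<close> the new row is
  \<open>\<epsilon> l\<^sub>w A\<^sub>v + b\<^sub>w\<^sup>T G\<^sub>v A\<^sub>v\<close>. In the sum
  over the block the common sign factors out, and the second term vanishes because the columns
  \<open>b\<^sub>w\<close> add up to 0.\<close>

lemma vertex_form_change_variables:
  assumes v: "v \<in> verts M" and k: "k < n - 2"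
  obtains \<epsilon> :: int where "\<And>a. vertex_form M v k (change_variables a)
    = (\<Sum>l<n - 2. of_int (\<epsilon> * A v l k) * vertex_form M v l a)"
proof -
  let ?B = "bdry_index M v"
  obtain \<epsilon> where \<epsilon>: "\<And>w. w \<in> ?B \<Longrightarrow> P w 0 0 = \<epsilon>"
    by (rule block_sign) (rule that)
  have "vertex_form M v k (change_variables a) = (\<Sum>l<n - 2. of_int (\<epsilon> * A v l k) * vertex_form M v l a)" for a
  proof -
    let ?g = "\<lambda>h l. a (GVar v (min h l) (max h l))"
    have "change_variables a (LVar w k) = (\<Sum>l<n - 2. of_int (\<epsilon> * A v l k) * a (LVar w l))
        + (\<Sum>h<n - 2. \<Sum>l<n - 2. of_int (P w (Suc h) 0) * (?g h l * of_int (A v l k)))" if w: "w \<in> ?B" for w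
    proof -
      have wt: "w \<in> tori M" and wv: "owner M w = v"
        using w by (simp_all add: bdry_index_def)
      have c: "P w 0 (Suc k) = 0" "\<And>l. l < n - 2 \<Longrightarrow> P w (Suc l) (Suc k) = A v l k"
        using basis_change_fiber_columns[OF wt k] wv by simp_all
      have "change_variables a (LVar w k) = (\<Sum>l<n - 2. of_int (P w 0 0) * a (LVar w l) * of_int (A v l k))
        + (\<Sum>h<n - 2. \<Sum>l<n - 2. of_int (P w (Suc h) 0) * ?g h l * of_int (A v l k))"
        unfolding change_variables_def congruence_transform_def old.n_Suc sum.lessThan_Suc_shift
        using c wv by (simp add: G_matrix_simps)
      then show ?thesis
        using \<epsilon>[OF w] by (simp add: mult_ac)
    qed
    then have "vertex_form M v k (change_variables a)
        = (\<Sum>w\<in>?B. \<Sum>l<n - 2. of_int (\<epsilon> * A v l k) * a (LVar w l))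
        + (\<Sum>w\<in>?B. \<Sum>h<n - 2. \<Sum>l<n - 2. of_int (P w (Suc h) 0) * (?g h l * of_int (A v l k)))"
      by (simp add: vertex_form_def sum.distrib)
    also have "(\<Sum>w\<in>?B. \<Sum>h<n - 2. \<Sum>l<n - 2. of_int (P w (Suc h) 0) * (?g h l * of_int (A v l k)))
        = (\<Sum>h<n - 2. \<Sum>l<n - 2. \<Sum>w\<in>?B. of_int (P w (Suc h) 0) * (?g h l * of_int (A v l k)))"
      by (subst sum.swap) (intro sum.cong refl sum.swap)
    also have "\<dots> = (\<Sum>h<n - 2. \<Sum>l<n - 2. of_int (\<Sum>w\<in>?B. P w (Suc h) 0) * (?g h l * of_int (A v l k)))"
      by (simp add: sum_distrib_right)
    also have "\<dots> = 0"
      using basis_change_first_column_sum[OF v] by simp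
    also have "(\<Sum>w\<in>?B. \<Sum>l<n - 2. of_int (\<epsilon> * A v l k) * a (LVar w l))
        = (\<Sum>l<n - 2. of_int (\<epsilon> * A v l k) * vertex_form M v l a)"
      unfolding vertex_form_def sum_distrib_left by (rule sum.swap)
    finally show ?thesis
      by simp
  qed
  then show thesis
    by (rule that)
qed

lemma pullback_in_span:
  assumes "e \<in> LS1_equations n M z' f'"
  shows "e \<circ> change_variables \<in> forms.span (LS1_equations n M z f)"
  using assms unfolding LS1_equations_eq[of n M z' f']
proof
  let ?E = "LS1_equations n M z f"
  assume "e \<in> {gluing_form n M z' f' w i j |w i j. w \<in> glued M \<and> i < n - 1 \<and> j < n - 1}"
  then obtain w i j where e: "e = gluing_form n M z' f' w i j" and w: "w \<in> glued M" "i < n - 1" "j < n - 1"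
    by blast
  have "e \<circ> change_variables
      = (\<Sum>k<n - 1. \<Sum>l<n - 1. (\<lambda>a. of_int (P (opp M w) k i * P (opp M w) l j) * gluing_form n M z f w k l a))"
    by (simp add: fun_eq_iff sum_fun_apply e gluing_form_change_variables[OF w])
  also have "\<dots> \<in> forms.span ?E"
    using w(1) by (intro forms.span_sum forms.span_scale forms.span_base) (auto simp: LS1_equations_eq)
  finally show ?thesis .
next
  let ?E = "LS1_equations n M z f"
  assume "e \<in> {vertex_form M v k |v k. v \<in> verts M \<and> k < n - 2}"
  then obtain v k where e: "e = vertex_form M v k" and v: "v \<in> verts M" "k < n - 2"
    by blast
  obtain \<epsilon> where \<epsilon>: "\<And>a. vertex_form M v k (change_variables a)
    = (\<Sum>l<n - 2. of_int (\<epsilon> * A v l k) * vertex_form M v l a)"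
    by (rule vertex_form_change_variables[OF v]) (rule that)
  have "e \<circ> change_variables = (\<Sum>l<n - 2. (\<lambda>a. of_int (\<epsilon> * A v l k) * vertex_form M v l a))"
    by (simp add: fun_eq_iff sum_fun_apply e \<epsilon>)
  also have "\<dots> \<in> forms.span ?E"
    using v(1) by (intro forms.span_sum forms.span_scale forms.span_base) (auto simp: LS1_equations_eq)
  finally show ?thesis .
qed

lemma rank_LS1_le: "rank_of_forms (LS1_equations n M z' f') \<le> rank_of_forms (LS1_equations n M z f)"
proof -
  interpret rev: Waldhausen_pair n M z' f' z f
    by unfold_locales
  show ?thesis
  proof (rule rank_of_forms_le[OF old.finite_LS1_equations pullback_in_span])
    fix e assume e: "e \<in> LS1_equations n M z' f'"
    show "e \<circ> change_variables \<circ> rev.change_variables = e"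
    proof
      fix a
      \<comment> \<open>The composite substitution is congruence by \<open>Q P\<close>, which is the
        identity matrix.\<close>
      have "G_matrix M w (change_variables (rev.change_variables a)) i j = G_matrix M w a i j"
        if w: "w \<in> tori M" and ij: "i < n - 1" "j < n - 1" for w i j
      proof -
        have "G_matrix M w (change_variables (rev.change_variables a)) i j
            = congruence_transform (n - 1) (\<lambda>k l. of_int (P w k l)) (G_matrix M w (rev.change_variables a)) i j"
          by (rule G_matrix_change_variables[OF w ij])
        also have "\<dots> = congruence_transform (n - 1) (\<lambda>k l. of_int (P w k l))
            (congruence_transform (n - 1) (\<lambda>k l. of_int (Q w k l)) (G_matrix M w a)) i j"
          by (rule congruence_transform_cong) (simp_all add: rev.G_matrix_change_variables[OF w])
        also have "\<dots> = congruence_transform (n - 1) (\<lambda>k l. \<Sum>h<n - 1. of_int (Q w k h) * of_int (P w h l)) (G_matrix M w a) i j"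
          by (rule congruence_transform_transform)
        also have "\<dots> = G_matrix M w a i j"
        proof (rule congruence_transform_id[OF ij])
          show "(\<Sum>h<n - 1. real_of_int (Q w k h) * real_of_int (P w h l)) = of_bool (k = l)"
            if "k < n - 1" "l < n - 1" for k l
            using arg_cong[OF rev.basis_change_inverse[OF w that], of real_of_int] by simp
        qed
        finally show ?thesis .
      qed
      from old.LS1_equations_local[OF e this] show "(e \<circ> change_variables \<circ> rev.change_variables) a = e a"
        by simp
    qed
  qed
qed

end

theorem theorem4p1:
  fixes n :: nat
    and M :: "('v, 'w, 'a, 'b, 'c) graph_manifold"
    and z z' :: "'w \<Rightarrow> 'a chain set"
    and f f' :: "'v \<Rightarrow> nat \<Rightarrow> (nat \<Rightarrow> complex) chain set"
  assumes "n \<ge> 3"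
    and "generalized_graph_manifold n M"
    and "Waldhausen_basis n M z f"
    and "Waldhausen_basis n M z' f'"
  shows "LS1_corank n M z f = LS1_corank n M z' f'"
proof -
  interpret pair: Waldhausen_pair n M z f z' f'
    using assms by unfold_locales
  interpret rev: Waldhausen_pair n M z' f' z f
    by unfold_locales
  \<comment> \<open>The number of variables does not depend on the basis, so equality of the ranks
    is enough.\<close>
  show ?thesis
    using pair.rank_LS1_le rev.rank_LS1_le by (simp add: LS1_corank_def)
qed

end
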